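(* Let $r\geq 3$ be a fixed integer. For infinitely many positive integers $n$, let $\mathbf{k}=\mathbf{k}(n)=(k_1,\ldots,k_n)$ be a vector of nonnegative integers whose sum $M=\sum_{i=1}^n k_i$ is divisible by $r$ (asymptotics are taken along these $n$). Let $k_{\max}=\max_i k_i$ and $M_2=\sum_{i=1}^n k_i(k_i-1)$. Suppose that $n\to\infty$, $M\to\infty$, $k_{\max}\geq 2$ and $k_{\max}^3=o(M)$. Then \[ |\mathcal{H}_r(\mathbf{k})| = \frac{M!}{(M/r)!\,(r!)^{M/r}\,\prod_{i=1}^n k_i!}\,\exp\Bigl(-\frac{(r-1)M_2}{2M}+O(k_{\max}^3/M)\Bigr). \]
   Context: A hypergraph on vertex set $\{1,\ldots,n\}$ here has a multiset of edges, each edge being a multisubset of the vertex set. It is $r$-uniform if every edge has exactly $r$ vertices counted with multiplicity. A vertex of multiplicity at least 2 in an edge is a loop; a hypergraph is simple if it has no loops and no repeated edges. The degree of vertex $i$ is the total number of times it appears in edges (counted with multiplicity). $\mathcal{H}_r(\mathbf{k})$ denotes the set of simple $r$-uniform hypergraphs on vertex set $\{1,\ldots,n\}$ in which vertex $i$ has degree $k_i$ for each $i$. *)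

theory Defs
  imports Complex_Main "HOL-Library.Multiset" "HOL-Library.Landau_Symbols"
begin

text \<open>
  A hypergraph is a multiset of edges, and an edge is a multiset of vertices.
\<close>

type_synonym 'v hypergraph = "'v multiset multiset"

definition hypergraph_on :: "'v set \<Rightarrow> 'v hypergraph \<Rightarrow> bool" where
  "hypergraph_on V H \<longleftrightarrow> (\<forall>e\<in>#H. set_mset e \<subseteq> V)"

definition uniform_hypergraph :: "nat \<Rightarrow> 'v hypergraph \<Rightarrow> bool" where
  "uniform_hypergraph r H \<longleftrightarrow> (\<forall>e\<in>#H. size e = r)"

definition is_loop :: "'v \<Rightarrow> 'v multiset \<Rightarrow> bool" where
  "is_loop v e \<longleftrightarrow> count e v \<ge> 2"

definition simple_hypergraph :: "'v hypergraph \<Rightarrow> bool" where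
  "simple_hypergraph H \<longleftrightarrow> (\<forall>e\<in>#H. \<not> (\<exists>v. is_loop v e)) \<and> (\<forall>e\<in>#H. count H e = 1)"

definition vertex_degree :: "'v hypergraph \<Rightarrow> 'v \<Rightarrow> nat" where
  "vertex_degree H v = (\<Sum>e\<in>#H. count e v)"

text \<open>
  A degree vector \<open>(k\<^sub>1, \<dots>, k\<^sub>n)\<close> is a function \<open>k\<close>, of which only the values on
  \<open>{1..n}\<close> matter; this is why the length \<open>n\<close> is an explicit argument below.
\<close>

definition simple_hypergraphs :: "nat \<Rightarrow> nat \<Rightarrow> (nat \<Rightarrow> nat) \<Rightarrow> nat hypergraph set" where
  "simple_hypergraphs r n k =
     {H. hypergraph_on {1..n} H \<and> uniform_hypergraph r H \<and> simple_hypergraph H \<and>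
       (\<forall>i\<in>{1..n}. vertex_degree H i = k i)}"

definition deg_sum :: "nat \<Rightarrow> (nat \<Rightarrow> nat) \<Rightarrow> nat" where
  "deg_sum n k = (\<Sum>i=1..n. k i)"

definition deg_max :: "nat \<Rightarrow> (nat \<Rightarrow> nat) \<Rightarrow> nat" where
  "deg_max n k = Max (k ` {1..n})"

text \<open>Truncated subtraction is harmless here: the summand is \<open>0\<close> when \<open>k i = 0\<close>.\<close>

definition deg_sum2 :: "nat \<Rightarrow> (nat \<Rightarrow> nat) \<Rightarrow> nat" where
  "deg_sum2 n k = (\<Sum>i=1..n. k i * (k i - 1))"

text \<open>The filter of \<open>n\<close> tending to infinity through the members of \<open>S\<close>.\<close>

definition at_top_along :: "nat set \<Rightarrow> nat filter" where
  "at_top_along S = inf at_top (principal S)"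

text \<open>
  The filter is proper for infinite \<open>S\<close>, and the set of hypergraphs being counted is
  finite, so neither asymptotics nor cardinality degenerates.
\<close>

lemma at_top_along_neq_bot:
  assumes "infinite S"
  shows "at_top_along S \<noteq> bot"
proof
  assume "at_top_along S = bot"
  then obtain N where "\<forall>n\<ge>N. n \<notin> S"
    unfolding at_top_along_def trivial_limit_def eventually_inf_principal eventually_sequentially
    by blast
  then have "S \<subseteq> {..<N}" by (meson lessThan_iff not_le subsetI)
  with assms show False using finite_subset by blast
qed

lemma finite_simple_hypergraphs: "finite (simple_hypergraphs r n k)"
proof -
  let ?E = "mset_set ` Pow {1..n}"
  have "simple_hypergraphs r n k \<subseteq> mset_set ` Pow ?E"
  proof
    fix H assume "H \<in> simple_hypergraphs r n k"
    then have on: "\<And>e. e \<in># H \<Longrightarrow> set_mset e \<subseteq> {1..n}"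
      and loop: "\<And>e v. e \<in># H \<Longrightarrow> count e v < 2"
      and one: "\<And>e. e \<in># H \<Longrightarrow> count H e = 1"
      by (auto simp: simple_hypergraphs_def hypergraph_on_def simple_hypergraph_def is_loop_def not_le)
    have "e \<in> ?E" if "e \<in># H" for e
    proof -
      have "e = mset_set (set_mset e)"
      proof (rule multiset_eqI)
        fix v
        have "count e v = (if v \<in># e then 1 else 0)"
        proof (cases "v \<in># e")
          case True
          then have "0 < count e v" by (rule count_greater_zero_iff[THEN iffD2])
          with loop[OF that, of v] have "count e v = 1" by linarith
          with True show ?thesis by simp
        qed (simp add: not_in_iff)
        then show "count e v = count (mset_set (set_mset e)) v"
          by (simp only: count_mset_set' finite_set_mset simp_thms)
      qed
      then show ?thesis using on[OF that] by blast
    qed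
    then have "set_mset H \<in> Pow ?E" by blast
    moreover have "H = mset_set (set_mset H)"
    proof (rule multiset_eqI)
      fix e
      show "count H e = count (mset_set (set_mset H)) e"
        using one[of e] by (cases "e \<in># H") (auto simp: not_in_iff)
    qed
    ultimately show "H \<in> mset_set ` Pow ?E" by blast
  qed
  then show ?thesis by (rule finite_subset) simp
qed

end

theory Submission
  imports Defs "HOL-Library.FuncSet" "HOL-Combinatorics.Transposition"
    "HOL-Combinatorics.Multiset_Permutations"
begin

text \<open>
  Instead of pairings of points we count words: maps from the \<open>m * r\<close> slots (\<open>m = M / r\<close> blocks of
  size \<open>r\<close>) to vertices in which vertex \<open>i\<close> occurs \<open>k i\<close> times. Each simple hypergraph arises from
  exactly \<open>m! r!^m\<close> words, so the claim is about the probability that a random word is simple.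

  Let \<open>N w\<close> be the number of loops of the word \<open>w\<close> (pairs of equal letters within a block) and
  \<open>Z x = (\<Sum>w. x ^ N w)\<close>. Swapping one end of a loop with a slot of another block turns a pair of equal
  letters inside a block into one across blocks. Counting such swaps with weights \<open>x ^ N w\<close> shows
  \<open>Z' x / Z x = \<mu> + O(kmax^2 / M)\<close> uniformly in \<open>x \<in> [0, 1]\<close>, where \<open>\<mu> = (r - 1) M2 / (2 M)\<close>.
  Integrating from \<open>0\<close> to \<open>1\<close>, the proportion \<open>Z 0 / Z 1\<close> of loop-free words is
  \<open>exp (- \<mu> + O(kmax^2 / M))\<close>; this works even when \<open>\<mu>\<close> is unbounded. Among loop-free words, two
  equal blocks need three coincidences of letters, each of which a swap shows to have conditional
  probability \<open>O(kmax / M)\<close>; with \<open>O(M^2)\<close> choices of slots this contributes \<open>O(kmax^3 / M)\<close>.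
\<close>

subsection \<open>Arrangements of a multiset\<close>

text \<open>Extensionality fixes the value outside \<open>Y\<close>, so that each arrangement is
  counted once.\<close>

definition arrangements :: "'b set \<Rightarrow> 'a multiset \<Rightarrow> ('b \<Rightarrow> 'a) set" where
  "arrangements Y A = {f \<in> Y \<rightarrow>\<^sub>E UNIV. image_mset f (mset_set Y) = A}"

lemma arrangementsD:
  assumes "f \<in> arrangements Y A"
  shows "f \<in> extensional Y" "image_mset f (mset_set Y) = A"
  using assms by (auto simp: arrangements_def PiE_def)

text \<open>Listing the values along a fixed enumeration of \<open>Y\<close> transfers the known
  count of the permutations of a multiset.\<close>

lemma bij_betw_arrangements_permutations:
  assumes "distinct xs" and "size A = length xs"
  shows "bij_betw (\<lambda>f. map f xs) (arrangements (set xs) A) (permutations_of_multiset A)"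
proof -
  have mset: "mset_set (set xs) = mset xs"
    using assms by (simp add: mset_set_set)
  show ?thesis
  proof (rule bij_betw_imageI)
    show "inj_on (\<lambda>f. map f xs) (arrangements (set xs) A)"
    proof (rule inj_onI)
      fix f g assume "f \<in> arrangements (set xs) A" "g \<in> arrangements (set xs) A"
        and "map f xs = map g xs"
      then show "f = g"
        by (intro extensionalityI[of f "set xs" g]) (auto dest: arrangementsD)
    qed
    show "(\<lambda>f. map f xs) ` arrangements (set xs) A = permutations_of_multiset A"
    proof (intro equalityI subsetI)
      fix ys assume "ys \<in> (\<lambda>f. map f xs) ` arrangements (set xs) A"
      then show "ys \<in> permutations_of_multiset A"
        by (auto simp: permutations_of_multiset_def mset dest: arrangementsD)
    next
      fix ys assume ys: "ys \<in> permutations_of_multiset A"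
      then show "ys \<in> (\<lambda>f. map f xs) ` arrangements (set xs) A"
      proof -
        have len: "length ys = length xs"
          using ys assms(2) by (metis permutations_of_multisetD size_mset)
        \<comment> \<open>The inverse looks each slot up in the association list; the restriction
          makes it extensional.\<close>
        define f where "f = restrict (\<lambda>y. the (map_of (zip xs ys) y)) (set xs)"
        have nth: "f (xs ! i) = ys ! i" if "i < length xs" for i
          using that assms len by (simp add: f_def map_of_zip_nth)
        have "map f xs = ys"
          using len by (intro nth_equalityI) (auto simp: nth)
        moreover have "f \<in> arrangements (set xs) A"
          using ys \<open>map f xs = ys\<close> unfolding arrangements_def
          by (auto simp: mset permutations_of_multiset_def f_def simp flip: mset_map)
        ultimately show ?thesis by blast
      qed
    qed
  qed
qed

text \<open>The multinomial coefficient, in product form so that no division of naturals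
  occurs.\<close>

lemma card_arrangements:
  assumes "finite Y" and "size A = card Y"
  shows "card (arrangements Y A) * (\<Prod>x\<in>set_mset A. fact (count A x)) = fact (card Y)"
proof -
  obtain xs where xs: "set xs = Y" "distinct xs"
    using assms(1) finite_distinct_list by blast
  have "card (arrangements Y A) = card (permutations_of_multiset A)"
    using bij_betw_same_card[OF bij_betw_arrangements_permutations[of xs A]] xs assms(2)
    by (simp add: distinct_card[of xs, symmetric])
  then show ?thesis
    using card_permutations_of_multiset_aux[of A] assms(2) by simp
qed

lemma finite_arrangements:
  assumes "finite Y"
  shows "finite (arrangements Y A)"
proof -
  have "arrangements Y A \<subseteq> Y \<rightarrow>\<^sub>E set_mset A"
    using assms by (auto simp: arrangements_def)
  then show ?thesis
    using assms by (meson finite_PiE finite_set_mset finite_subset)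
qed

lemma arrangements_transpose:
  assumes "f \<in> arrangements Y A" and "finite Y" "s \<in> Y" "u \<in> Y"
  shows "f \<circ> transpose s u \<in> arrangements Y A"
proof -
  have "image_mset (transpose s u) (mset_set Y) = mset_set Y"
    using assms by (subst image_mset_mset_set) (auto simp: transpose_image_eq)
  then have "image_mset (f \<circ> transpose s u) (mset_set Y) = A"
    using arrangementsD(2)[OF assms(1)] by (simp flip: multiset.map_comp)
  moreover have "f \<circ> transpose s u \<in> extensional Y"
    using arrangementsD(1)[OF assms(1)] assms(3,4)
    by (auto simp: extensional_def transpose_def)
  ultimately show ?thesis by (auto simp: arrangements_def PiE_def)
qed

lemma count_image_mset_set:
  "finite Y \<Longrightarrow> count (image_mset f (mset_set Y)) a = card {s \<in> Y. f s = a}"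
  by (auto simp: count_image_mset intro!: arg_cong[of _ _ card])

lemma card_arrangements_fibre:
  assumes "f \<in> arrangements Y A" and "finite Y"
  shows "card {s \<in> Y. f s = a} = count A a"
  using count_image_mset_set[OF assms(2), of f a] arrangementsD(2)[OF assms(1)] by simp

definition block_edge :: "nat \<Rightarrow> (nat \<times> nat \<Rightarrow> 'a) \<Rightarrow> nat \<Rightarrow> 'a multiset" where
  "block_edge r w b = image_mset (\<lambda>j. w (b, j)) (mset_set {..<r})"

subsection \<open>Words and their loops\<close>

text \<open>The letters are abstract here. Later \<open>A\<close> holds vertex \<open>i\<close> with
  multiplicity \<open>k i\<close>, and \<open>K\<close> is a bound on the degrees.\<close>

locale block_words =
  fixes m r K :: nat and A :: "'a multiset"
  assumes size_A: "size A = m * r"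
    and count_le: "count A a \<le> K"
begin

definition slots :: "(nat \<times> nat) set" where
  "slots = {..<m} \<times> {..<r}"

abbreviation words :: "(nat \<times> nat \<Rightarrow> 'a) set" where
  "words \<equiv> arrangements slots A"

text \<open>A letter occurring \<open>c\<close> times in a block contributes
  \<open>c * (c - 1) / 2\<close> pairs. \<open>loops\<close> below holds each pair in both orders,
  which makes counting by an endpoint symmetric.\<close>

definition nloops :: "(nat \<times> nat \<Rightarrow> 'a) \<Rightarrow> nat" where
  "nloops w = card {(s, t). s \<in> slots \<and> t \<in> slots \<and> fst s = fst t \<and> snd s < snd t \<and> w s = w t}"

definition loops :: "(nat \<times> nat \<Rightarrow> 'a) \<Rightarrow> ((nat \<times> nat) \<times> (nat \<times> nat)) set" where
  "loops w = {(s, t). s \<in> slots \<and> t \<in> slots \<and> fst s = fst t \<and> s \<noteq> t \<and> w s = w t}"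

definition loops_at :: "(nat \<times> nat \<Rightarrow> 'a) \<Rightarrow> nat \<times> nat \<Rightarrow> (nat \<times> nat) set" where
  "loops_at w p = {q \<in> slots. q \<noteq> p \<and> fst q = fst p \<and> w q = w p}"

lemma finite_slots [simp]: "finite slots"
  by (simp add: slots_def)

lemma card_slots: "card slots = m * r"
  by (simp add: slots_def)

lemma finite_words [simp]: "finite words"
  by (simp add: finite_arrangements)

lemma finite_loops [simp]: "finite (loops w)"
  by (rule finite_subset[of _ "slots \<times> slots"]) (auto simp: loops_def)

lemma finite_loops_at [simp]: "finite (loops_at w p)"
  by (simp add: loops_at_def)

lemma card_block: "b < m \<Longrightarrow> card {q \<in> slots. fst q = b} = r"
proof -
  assume "b < m"
  then have "{q \<in> slots. fst q = b} = {b} \<times> {..<r}" by (auto simp: slots_def)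
  then show ?thesis by simp
qed

lemma card_block_slot: "p \<in> slots \<Longrightarrow> card {q \<in> slots. fst q = fst p} = r"
  by (rule card_block) (auto simp: slots_def)

lemma card_letter_le: "w \<in> words \<Longrightarrow> card {q \<in> slots. w q = a} \<le> K"
  by (simp add: card_arrangements_fibre count_le)

lemma card_words: "card words * (\<Prod>x\<in>set_mset A. fact (count A x)) = fact (m * r)"
  using card_arrangements[of slots A] by (simp add: card_slots size_A)

section \<open>Effect of a swap on the number of loops\<close>

lemma card_loops: "card (loops w) = 2 * nloops w"
proof -
  define U where "U = {(s, t). s \<in> slots \<and> t \<in> slots \<and> fst s = fst t \<and> snd s < snd t \<and> w s = w t}"
  have fin: "finite U" by (rule finite_subset[of _ "slots \<times> slots"]) (auto simp: U_def)
  have "loops w = U \<union> prod.swap ` U"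
  proof (intro equalityI subsetI)
    fix x assume x: "x \<in> loops w"
    obtain s t where st: "x = (s, t)" by (cases x)
    have "snd s \<noteq> snd t" using x st by (auto simp: loops_def prod_eq_iff)
    then consider "snd s < snd t" | "snd t < snd s" by linarith
    then show "x \<in> U \<union> prod.swap ` U"
    proof cases
      case 2
      then have "(t, s) \<in> U" using x st by (auto simp: loops_def U_def)
      then show ?thesis using st by force
    qed (use x st in \<open>auto simp: loops_def U_def\<close>)
  qed (auto simp: loops_def U_def)
  moreover have "U \<inter> prod.swap ` U = {}" by (auto simp: U_def)
  moreover have "card (prod.swap ` U) = card U" by (rule card_image) auto
  ultimately have "card (loops w) = 2 * card U" using fin by (simp add: card_Un_disjoint)
  then show ?thesis by (simp add: nloops_def U_def)
qed

text \<open>A loop lies within one block, so none contains both \<open>s\<close> and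
  \<open>u\<close>. The ordered loops through \<open>s\<close> and those through \<open>u\<close>
  are therefore disjoint sets, each of twice the size of \<open>loops_at\<close>.\<close>

lemma nloops_split:
  assumes "s \<in> slots" "u \<in> slots" "fst s \<noteq> fst u"
  shows "2 * nloops w = card {(p, q) \<in> loops w. {p, q} \<inter> {s, u} = {}}
    + 2 * card (loops_at w s) + 2 * card (loops_at w u)"
proof -
  let ?R = "{(p, q) \<in> loops w. {p, q} \<inter> {s, u} = {}}"
  let ?at = "\<lambda>p. {p} \<times> loops_at w p \<union> loops_at w p \<times> {p}"
  have at: "card (?at p) = 2 * card (loops_at w p)" for p
    by (subst card_Un_disjoint) (auto simp: loops_at_def)
  have "loops w = ?R \<union> (?at s \<union> ?at u)"
  proof (rule set_eqI)
    fix x :: "(nat \<times> nat) \<times> (nat \<times> nat)"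
    obtain p q where "x = (p, q)" by (cases x)
    then show "x \<in> loops w \<longleftrightarrow> x \<in> ?R \<union> (?at s \<union> ?at u)"
      using assms by (auto simp: loops_def loops_at_def)
  qed
  moreover have "finite ?R" by (rule finite_subset[of _ "loops w"]) auto
  moreover have "?at s \<inter> ?at u = {}"
    using assms by (auto simp: loops_at_def)
  moreover have "?R \<inter> (?at s \<union> ?at u) = {}" by auto
  moreover have "finite (?at p)" for p by simp
  ultimately have "card (loops w) = card ?R + (card (?at s) + card (?at u))"
    by (metis (no_types, lifting) card_Un_disjoint finite_UnI)
  then show ?thesis unfolding at card_loops by simp
qed

text \<open>Loops avoiding \<open>s\<close> and \<open>u\<close> are untouched by the swap. The
  additive form avoids truncated subtraction.\<close>

lemma nloops_transpose:
  fixes w :: "nat \<times> nat \<Rightarrow> 'a"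
  assumes "s \<in> slots" "u \<in> slots" "fst s \<noteq> fst u"
  defines "w' \<equiv> w \<circ> transpose s u"
  shows "nloops w' + card (loops_at w s) + card (loops_at w u)
    = nloops w + card (loops_at w' s) + card (loops_at w' u)"
proof -
  have "card {(p, q) \<in> loops w'. {p, q} \<inter> {s, u} = {}} = card {(p, q) \<in> loops w. {p, q} \<inter> {s, u} = {}}"
    by (rule arg_cong[of _ _ card]) (auto simp: loops_def w'_def)
  with nloops_split[OF assms(1-3), of w] nloops_split[OF assms(1-3), of w']
  show ?thesis by linarith
qed

definition bad_partners :: "(nat \<times> nat \<Rightarrow> 'a) \<Rightarrow> nat \<times> nat \<Rightarrow> (nat \<times> nat) set" where
  "bad_partners w s = {z \<in> slots. fst z \<noteq> fst s \<and>
     (loops_at (w \<circ> transpose s z) s \<noteq> {} \<or> loops_at (w \<circ> transpose s z) z \<noteq> {})}"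

lemma finite_bad_partners [simp]: "finite (bad_partners w s)"
  by (simp add: bad_partners_def)

text \<open>After the swap, a loop at \<open>s\<close> means that \<open>w z\<close> was one of the
  \<open>r\<close> letters in the block of \<open>s\<close>, each occurring at most \<open>K\<close>
  times. A loop at \<open>z\<close> means that the block of \<open>z\<close> contains one of the at
  most \<open>K\<close> occurrences of \<open>w s\<close>. Each case accounts for at most
  \<open>r * K\<close> slots.\<close>

lemma card_bad_partners:
  assumes w: "w \<in> words" and s: "s \<in> slots"
  shows "card (bad_partners w s) \<le> 2 * r * K"
proof -
  let ?B1 = "\<Union>q\<in>{q \<in> slots. fst q = fst s}. {z \<in> slots. w z = w q}"
  let ?B2 = "\<Union>q\<in>{q \<in> slots. w q = w s}. {z \<in> slots. fst z = fst q}"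
  have "bad_partners w s \<subseteq> ?B1 \<union> ?B2"
  proof
    fix z assume z: "z \<in> bad_partners w s"
    then consider q where "q \<in> loops_at (w \<circ> transpose s z) s" | q where "q \<in> loops_at (w \<circ> transpose s z) z"
      by (auto simp: bad_partners_def)
    then show "z \<in> ?B1 \<union> ?B2"
    proof cases
      case 1
      then have "q \<noteq> z" using z by (auto simp: bad_partners_def loops_at_def)
      with 1 have "w q = w z" by (auto simp: loops_at_def)
      with 1 z show ?thesis by (fastforce simp: bad_partners_def loops_at_def)
    next
      case 2
      then have "q \<noteq> s" using z by (auto simp: bad_partners_def loops_at_def)
      with 2 have "w q = w s" by (auto simp: loops_at_def)
      with 2 z show ?thesis by (fastforce simp: bad_partners_def loops_at_def)
    qed
  qed
  then have "card (bad_partners w s) \<le> card (?B1 \<union> ?B2)"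
    by (rule card_mono[rotated]) simp
  also have "\<dots> \<le> card ?B1 + card ?B2" by (rule card_Un_le)
  also have "card ?B1 \<le> (\<Sum>q\<in>{q \<in> slots. fst q = fst s}. card {z \<in> slots. w z = w q})"
    by (rule card_UN_le) simp
  also have "\<dots> \<le> card {q \<in> slots. fst q = fst s} * K"
    using sum_bounded_above[of "{q \<in> slots. fst q = fst s}" "\<lambda>q. card {z \<in> slots. w z = w q}" K]
      card_letter_le[OF w] by simp
  also have "\<dots> = r * K" using s by (simp add: card_block_slot)
  also have "card ?B2 \<le> (\<Sum>q\<in>{q \<in> slots. w q = w s}. card {z \<in> slots. fst z = fst q})"
    by (rule card_UN_le) simp
  also have "\<dots> = card {q \<in> slots. w q = w s} * r"
    by (simp add: card_block_slot)
  also have "\<dots> \<le> K * r" by (rule mult_right_mono) (auto simp: card_letter_le[OF w])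
  finally show ?thesis by (simp add: mult_ac)
qed

lemma words_transpose:
  "w \<in> words \<Longrightarrow> s \<in> slots \<Longrightarrow> u \<in> slots \<Longrightarrow> w \<circ> transpose s u \<in> words"
  by (rule arrangements_transpose) auto

lemma comp_transpose_twice [simp]: "(w \<circ> transpose s u) \<circ> transpose s u = w"
  by (simp add: comp_assoc)

text \<open>The function \<open>Z\<close> of the overview. At 1 it counts all words and at 0, since
  \<open>0 ^ 0 = 1\<close>, the loop-free ones.\<close>

definition loop_poly :: "real \<Rightarrow> real" where
  "loop_poly x = (\<Sum>w\<in>words. x ^ nloops w)"

text \<open>
  Swapping the letter in slot \<open>s\<close> with a random one destroys the coincidence \<open>w s = w t\<close> and,
  for most choices, creates no loop.
\<close>

lemma coincidence_unlikely:
  assumes x: "0 \<le> x" "x \<le> 1" and s: "s \<in> slots" and t: "t \<in> slots" and st: "fst s \<noteq> fst t"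
    and P: "\<And>w z. z \<in> slots \<Longrightarrow> fst z \<noteq> fst s \<Longrightarrow> fst z \<noteq> fst t \<Longrightarrow> P w
      \<Longrightarrow> P (w \<circ> transpose s z)"
    and K: "0 < K" and M: "8 * r * K \<le> m * r"
  shows "(\<Sum>w\<in>{w\<in>words. w s = w t \<and> P w}. x ^ nloops w)
    \<le> (2 * K / (m * r)) * (\<Sum>w\<in>{w\<in>words. P w}. x ^ nloops w)"
proof -
  \<comment> \<open>Swaps of \<open>s\<close> with these slots preserve \<open>P\<close> and create
    no loop.\<close>
  define G where "G w = {z \<in> slots. fst z \<noteq> fst s \<and> fst z \<noteq> fst t} - bad_partners w s" for w
  have cardG: "real (m * r) / 2 \<le> card (G w)" if w: "w \<in> words" for w
  proof -
    have "slots \<subseteq> G w \<union> ({z \<in> slots. fst z = fst s} \<union> {z \<in> slots. fst z = fst t} \<union> bad_partners w s)"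
      by (auto simp: G_def)
    then have "card slots \<le> card (G w \<union> ({z \<in> slots. fst z = fst s} \<union> {z \<in> slots. fst z = fst t} \<union> bad_partners w s))"
      by (rule card_mono[rotated]) (simp add: G_def)
    also have "\<dots> \<le> card (G w) + (card {z \<in> slots. fst z = fst s} + card {z \<in> slots. fst z = fst t} + card (bad_partners w s))"
      by (meson add_mono card_Un_le le_refl order_trans)
    also have "\<dots> \<le> card (G w) + (r + r + 2 * r * K)"
      using s t card_bad_partners[OF w s] by (simp add: card_block_slot)
    \<comment> \<open>As \<open>K\<close> is positive, at most \<open>4 * r * K\<close> slots are
      excluded, which by \<open>M\<close> is at most half of them.\<close>
    also have "r + r + 2 * r * K \<le> 4 * r * K" using K by (cases K) auto
    finally have "m * r \<le> card (G w) + 4 * r * K" by (simp add: card_slots)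
    with M have "m * r \<le> 2 * card (G w)" by linarith
    then have "real (m * r) \<le> real (2 * card (G w))" by (rule of_nat_mono)
    then show ?thesis by simp
  qed
  let ?E = "{w\<in>words. w s = w t \<and> P w}" and ?F = "{w\<in>words. P w}"
  \<comment> \<open>Recording \<open>z\<close> makes the swap invertible.\<close>
  have inj: "inj_on (\<lambda>(w, z). (w \<circ> transpose s z, z)) (Sigma ?E G)"
    by (rule inj_on_inverseI[of _ "\<lambda>(w, z). (w \<circ> transpose s z, z)"]) auto
  have "(\<Sum>w\<in>?E. x ^ nloops w) * (real (m * r) / 2) \<le> (\<Sum>w\<in>?E. \<Sum>z\<in>G w. x ^ nloops w)"
    unfolding sum_distrib_right
  proof (rule sum_mono)
    fix w assume "w \<in> ?E"
    then have "x ^ nloops w * (real (m * r) / 2) \<le> x ^ nloops w * card (G w)"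
      using cardG x by (intro mult_left_mono) auto
    then show "x ^ nloops w * (real (m * r) / 2) \<le> (\<Sum>z\<in>G w. x ^ nloops w)"
      by (simp add: mult.commute)
  qed
  also have "\<dots> = (\<Sum>(w, z)\<in>Sigma ?E G. x ^ nloops w)"
    by (rule sum.Sigma) (auto simp: G_def)
  also have "\<dots> \<le> (\<Sum>(w, z)\<in>Sigma ?E G. x ^ nloops (w \<circ> transpose s z))"
  proof (intro sum_mono, clarify)
    fix w z assume w: "w \<in> words" and "z \<in> G w"
    then have z: "z \<in> slots" "fst s \<noteq> fst z" and "loops_at (w \<circ> transpose s z) s = {}"
        "loops_at (w \<circ> transpose s z) z = {}"
      by (auto simp: G_def bad_partners_def)
    with nloops_transpose[OF s z, of w]
    have "nloops (w \<circ> transpose s z) \<le> nloops w" by simp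
    with x show "x ^ nloops w \<le> x ^ nloops (w \<circ> transpose s z)"
      by (intro power_decreasing)
  qed
  also have "\<dots> = (\<Sum>(w, z)\<in>(\<lambda>(w, z). (w \<circ> transpose s z, z)) ` Sigma ?E G. x ^ nloops w)"
    unfolding sum.reindex[OF inj] by (rule sum.cong) auto
  \<comment> \<open>The letter moved to \<open>z\<close> still equals the one in \<open>t\<close>,
    so a given image word allows at most \<open>K\<close> values of \<open>z\<close>.\<close>
  also have "\<dots> \<le> (\<Sum>(w, z)\<in>Sigma ?F (\<lambda>w. {z \<in> slots. w z = w t}). x ^ nloops w)"
  proof (rule sum_mono2)
    show "(\<lambda>(w, z). (w \<circ> transpose s z, z)) ` Sigma ?E G \<subseteq> Sigma ?F (\<lambda>w. {z \<in> slots. w z = w t})"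
    proof (rule image_subsetI)
      fix y assume "y \<in> Sigma ?E G"
      then obtain w z where y: "y = (w, z)" and w: "w \<in> words" "w s = w t" "P w" and "z \<in> G w"
        by blast
      then have z: "z \<in> slots" "fst z \<noteq> fst s" "fst z \<noteq> fst t" by (simp_all add: G_def)
      then have "z \<noteq> s" "t \<noteq> s" "t \<noteq> z" using st by auto
      then have "(w \<circ> transpose s z) z = (w \<circ> transpose s z) t"
        using w(2) \<open>z \<noteq> s\<close> \<open>t \<noteq> s\<close> \<open>t \<noteq> z\<close> by simp
      then show "(\<lambda>(w, z). (w \<circ> transpose s z, z)) y \<in> Sigma ?F (\<lambda>w. {z \<in> slots. w z = w t})"
        using y w z P[OF z w(3)] words_transpose[OF w(1) s z(1)] by simp
    qed
  qed (use x in \<open>auto\<close>)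
  also have "\<dots> = (\<Sum>w\<in>?F. \<Sum>z\<in>{z \<in> slots. w z = w t}. x ^ nloops w)"
    by (rule sum.Sigma[symmetric]) auto
  also have "\<dots> \<le> (\<Sum>w\<in>?F. K * x ^ nloops w)"
    using x by (intro sum_mono) (simp add: mult_right_mono card_letter_le)
  also have "\<dots> = K * (\<Sum>w\<in>?F. x ^ nloops w)"
    by (simp add: sum_distrib_left)
  finally have *: "(\<Sum>w\<in>?E. x ^ nloops w) * (real (m * r) / 2) \<le> K * (\<Sum>w\<in>?F. x ^ nloops w)" .
  have "0 < m * r" using s by (auto simp: slots_def)
  then have "0 < real (m * r)" by linarith
  with * show ?thesis by (simp add: field_simps del: of_nat_mult)
qed

end

subsection \<open>The loop switching\<close>

text \<open>A weighted union bound: each \<open>w\<close> on the left is counted at least once on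
  the right.\<close>

lemma sum_Collect_bex_le:
  fixes f :: "'b \<Rightarrow> real"
  assumes "finite B" "finite Q" and "\<And>w. w \<in> B \<Longrightarrow> 0 \<le> f w"
  shows "(\<Sum>w\<in>{w\<in>B. \<exists>q\<in>Q. R q w}. f w) \<le> (\<Sum>q\<in>Q. \<Sum>w\<in>{w\<in>B. R q w}. f w)"
proof -
  have "(\<Sum>w\<in>{w\<in>B. \<exists>q\<in>Q. R q w}. f w) \<le> (\<Sum>w\<in>{w\<in>B. \<exists>q\<in>Q. R q w}. \<Sum>q\<in>{q\<in>Q. R q w}. f w)"
  proof (rule sum_mono)
    fix w assume w: "w \<in> {w\<in>B. \<exists>q\<in>Q. R q w}"
    then have "{q\<in>Q. R q w} \<noteq> {}" by auto
    then have "1 \<le> card {q\<in>Q. R q w}" using assms(2) by (simp add: Suc_le_eq card_gt_0_iff)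
    then have "1 * f w \<le> real (card {q\<in>Q. R q w}) * f w"
      using assms(3) w by (intro mult_right_mono) auto
    then show "f w \<le> (\<Sum>q\<in>{q\<in>Q. R q w}. f w)" by simp
  qed
  also have "\<dots> \<le> (\<Sum>w\<in>B. \<Sum>q\<in>{q\<in>Q. R q w}. f w)"
    using assms by (intro sum_mono2) (auto intro!: sum_nonneg)
  also have "\<dots> = (\<Sum>q\<in>Q. \<Sum>w\<in>{w\<in>B. R q w}. f w)"
    using assms by (intro sum.swap_restrict)
  finally show ?thesis .
qed

lemma sum_Collect_disj_le:
  fixes f :: "'b \<Rightarrow> real"
  assumes "finite B" and "\<And>w. w \<in> B \<Longrightarrow> 0 \<le> f w"
  shows "(\<Sum>w\<in>{w\<in>B. P w \<or> Q w}. f w) \<le> (\<Sum>w\<in>{w\<in>B. P w}. f w) + (\<Sum>w\<in>{w\<in>B. Q w}. f w)"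
proof -
  have "{w\<in>B. P w \<or> Q w} = {w\<in>B. P w} \<union> {w\<in>B. Q w}" by auto
  moreover have "0 \<le> (\<Sum>w\<in>{w\<in>B. P w} \<inter> {w\<in>B. Q w}. f w)"
    using assms(2) by (intro sum_nonneg) auto
  ultimately show ?thesis using assms(1) by (simp add: sum_Un)
qed

context block_words
begin

text \<open>The derivative of \<open>loop_poly\<close>. For \<open>nloops w = 0\<close> the first
  factor vanishes, so the truncated exponent is harmless.\<close>

definition loop_poly_deriv :: "real \<Rightarrow> real" where
  "loop_poly_deriv x = (\<Sum>w\<in>words. real (nloops w) * x ^ (nloops w - 1))"

definition M2 :: nat where
  "M2 = (\<Sum>a\<in>set_mset A. count A a * (count A a - 1))"

lemma loop_poly_nonneg: "0 \<le> x \<Longrightarrow> 0 \<le> loop_poly x"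
  by (auto simp: loop_poly_def intro!: sum_nonneg)

lemma loop_poly_deriv_nonneg: "0 \<le> x \<Longrightarrow> 0 \<le> loop_poly_deriv x"
  by (auto simp: loop_poly_deriv_def intro!: sum_nonneg)

lemma sum_nloops_le_Z':
  assumes "0 \<le> x" "x \<le> 1"
  shows "(\<Sum>w\<in>words. real (nloops w) * x ^ nloops w) \<le> loop_poly_deriv x"
  unfolding loop_poly_deriv_def using assms
  by (intro sum_mono mult_left_mono power_decreasing) auto

section \<open>Counting coincidences and switchings\<close>

lemma letter_in: "w \<in> words \<Longrightarrow> s \<in> slots \<Longrightarrow> w s \<in># A"
  using arrangementsD(2)[of w slots A] by auto

text \<open>Given \<open>s\<close>, its partner is one of the \<open>count A (w s) - 1\<close> other
  slots with the same letter. Grouping by letters makes the total independent of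
  \<open>w\<close>.\<close>

lemma card_coincidences:
  assumes w: "w \<in> words"
  shows "card {(s, u). s \<in> slots \<and> u \<in> slots \<and> s \<noteq> u \<and> w s = w u} = M2"
proof -
  have "{(s, u). s \<in> slots \<and> u \<in> slots \<and> s \<noteq> u \<and> w s = w u}
      = (SIGMA s:slots. {u \<in> slots. w u = w s} - {s})"
    by auto
  also have "card \<dots> = (\<Sum>s\<in>slots. count A (w s) - 1)"
    by (simp add: card_Diff_subset card_arrangements_fibre[OF w])
  also have "\<dots> = (\<Sum>a\<in>set_mset A. \<Sum>s\<in>{s \<in> slots. w s = a}. count A (w s) - 1)"
    using letter_in[OF w] by (intro sum.group[symmetric]) auto
  also have "\<dots> = M2"
    by (simp add: M2_def card_arrangements_fibre[OF w])
  finally show ?thesis .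
qed

text \<open>An ordered coincidence either is a loop or joins two blocks, so the number of the latter
  kind depends on \<open>w\<close> only through \<open>nloops w\<close>.\<close>

lemma card_cross:
  assumes w: "w \<in> words"
  shows "card {(s, u). s \<in> slots \<and> u \<in> slots \<and> fst s \<noteq> fst u \<and> w s = w u} + 2 * nloops w = M2"
proof -
  let ?C = "{(s, u). s \<in> slots \<and> u \<in> slots \<and> fst s \<noteq> fst u \<and> w s = w u}"
  have "{(s, u). s \<in> slots \<and> u \<in> slots \<and> s \<noteq> u \<and> w s = w u} = ?C \<union> loops w"
    by (auto simp: loops_def)
  moreover have "?C \<inter> loops w = {}" by (auto simp: loops_def)
  moreover have "finite ?C" by (rule finite_subset[of _ "slots \<times> slots"]) auto
  ultimately have "M2 = card ?C + card (loops w)"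
    using card_coincidences[OF w] by (simp add: card_Un_disjoint)
  then show ?thesis by (simp add: card_loops)
qed

text \<open>A triple stands for the swap of \<open>s'\<close> and \<open>u\<close>. It moves one end
  of the loop \<open>{s, s'}\<close> to another block, turning \<open>w s = w s'\<close> into
  \<open>w s = w u\<close>.\<close>

definition switchings :: "((nat \<times> nat) \<times> (nat \<times> nat) \<times> (nat \<times> nat)) set" where
  "switchings = {(s, s', u). s \<in> slots \<and> s' \<in> slots \<and> u \<in> slots \<and>
     s \<noteq> s' \<and> fst s = fst s' \<and> fst u \<noteq> fst s}"

lemma finite_switchings [simp]: "finite switchings"
  by (rule finite_subset[of _ "slots \<times> slots \<times> slots"]) (auto simp: switchings_def)

lemma card_switchings_le: "card switchings \<le> (m * r)\<^sup>2 * r"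
proof -
  have "switchings \<subseteq> (\<lambda>((s, s'), u). (s, s', u)) ` ((SIGMA s:slots. {q \<in> slots. fst q = fst s}) \<times> slots)"
    by (auto simp: switchings_def image_iff)
  then have "card switchings \<le> card ((SIGMA s:slots. {q \<in> slots. fst q = fst s}) \<times> slots)"
    by (rule surj_card_le[rotated]) simp
  also have "\<dots> = (m * r)\<^sup>2 * r"
    by (simp add: card_cartesian_product card_block_slot card_slots power2_eq_square)
  finally show ?thesis .
qed

text \<open>Double counting turns sums over triples into counts of the triples that fit a single
  word.\<close>

lemma sum_switchings:
  "(\<Sum>(s, s', u)\<in>switchings. \<Sum>w\<in>{w\<in>words. R s s' u w}. f w)
    = (\<Sum>w\<in>words. real (card {(s, s', u). (s, s', u) \<in> switchings \<and> R s s' u w}) * f w)"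
proof -
  let ?R = "\<lambda>w. {\<tau>\<in>switchings. R (fst \<tau>) (fst (snd \<tau>)) (snd (snd \<tau>)) w}"
  have "(\<Sum>(s, s', u)\<in>switchings. \<Sum>w\<in>{w\<in>words. R s s' u w}. f w) = (\<Sum>w\<in>words. \<Sum>\<tau>\<in>?R w. f w)"
    unfolding case_prod_unfold by (rule sum.swap_restrict) auto
  moreover have "?R w = {(s, s', u). (s, s', u) \<in> switchings \<and> R s s' u w}" for w
    by auto
  ultimately show ?thesis by simp
qed

text \<open>There are \<open>2 * nloops w\<close> ordered loops, and \<open>u\<close> is any slot
  outside the block of the loop.\<close>

lemma card_switchings_loop:
  "card {(s, s', u). (s, s', u) \<in> switchings \<and> w s = w s'} = 2 * nloops w * (m * r - r)"
proof -
  have "card {(s, s', u). (s, s', u) \<in> switchings \<and> w s = w s'}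
      = card ((\<lambda>((s, s'), u). (s, s', u)) ` (SIGMA p:loops w. slots - {u \<in> slots. fst u = fst (fst p)}))"
    by (rule arg_cong[of _ _ card]) (auto simp: switchings_def loops_def image_iff)
  also have "\<dots> = card (SIGMA p:loops w. slots - {u \<in> slots. fst u = fst (fst p)})"
    by (rule card_image) (auto simp: inj_on_def)
  also have "\<dots> = (\<Sum>p\<in>loops w. m * r - r)"
  proof (subst card_SigmaI)
    have "card (slots - {u \<in> slots. fst u = fst (fst p)}) = m * r - r" if "p \<in> loops w" for p
    proof -
      have "fst p \<in> slots" using that by (auto simp: loops_def)
      then show ?thesis by (subst card_Diff_subset) (auto simp: card_slots card_block_slot)
    qed
    then show "(\<Sum>p\<in>loops w. card (slots - {u \<in> slots. fst u = fst (fst p)})) = (\<Sum>p\<in>loops w. m * r - r)"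
      by (rule sum.cong[OF refl])
  qed auto
  finally show ?thesis by (simp add: card_loops)
qed

text \<open>Here the coincidence \<open>(s, u)\<close> is chosen first; \<open>s'\<close> is then
  any of the \<open>r - 1\<close> other slots in the block of \<open>s\<close>.\<close>

lemma card_switchings_cross:
  assumes w: "w \<in> words"
  shows "card {(s, s', u). (s, s', u) \<in> switchings \<and> w s = w u} = (M2 - 2 * nloops w) * (r - 1)"
proof -
  let ?C = "{(s, u). s \<in> slots \<and> u \<in> slots \<and> fst s \<noteq> fst u \<and> w s = w u}"
  have "card {(s, s', u). (s, s', u) \<in> switchings \<and> w s = w u}
      = card ((\<lambda>((s, u), s'). (s, s', u)) ` (SIGMA p:?C. {q \<in> slots. fst q = fst (fst p)} - {fst p}))"
    by (rule arg_cong[of _ _ card]) (auto simp: switchings_def image_iff)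
  also have "\<dots> = card (SIGMA p:?C. {q \<in> slots. fst q = fst (fst p)} - {fst p})"
    by (rule card_image) (auto simp: inj_on_def)
  also have "\<dots> = (\<Sum>p\<in>?C. r - 1)"
  proof (subst card_SigmaI)
    show "finite ?C" by (rule finite_subset[of _ "slots \<times> slots"]) auto
    have "card ({q \<in> slots. fst q = fst (fst p)} - {fst p}) = r - 1" if "p \<in> ?C" for p
    proof -
      have "fst p \<in> slots" using that by auto
      then show ?thesis by (subst card_Diff_subset) (auto simp: card_block_slot)
    qed
    then show "(\<Sum>p\<in>?C. card ({q \<in> slots. fst q = fst (fst p)} - {fst p})) = (\<Sum>p\<in>?C. r - 1)"
      by (rule sum.cong[OF refl])
  qed auto
  also have "\<dots> = (M2 - 2 * nloops w) * (r - 1)"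
  proof -
    have "card ?C = M2 - 2 * nloops w" using card_cross[OF w] by linarith
    then show ?thesis by (simp only: sum_constant of_nat_id)
  qed
  finally show ?thesis .
qed

lemma card_switchings_bad:
  assumes w: "w \<in> words"
  shows "card {(s, s', u). (s, s', u) \<in> switchings \<and> w s = w s' \<and> u \<in> bad_partners w s'}
    \<le> 2 * nloops w * (2 * r * K)"
proof -
  have "{(s, s', u). (s, s', u) \<in> switchings \<and> w s = w s' \<and> u \<in> bad_partners w s'}
      \<subseteq> (\<lambda>((s, s'), u). (s, s', u)) ` (SIGMA p:loops w. bad_partners w (snd p))"
    by (auto simp: switchings_def loops_def image_iff)
  then have "card {(s, s', u). (s, s', u) \<in> switchings \<and> w s = w s' \<and> u \<in> bad_partners w s'}
      \<le> card (SIGMA p:loops w. bad_partners w (snd p))"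
    by (rule surj_card_le[rotated]) auto
  also have "\<dots> = (\<Sum>p\<in>loops w. card (bad_partners w (snd p)))" by simp
  also have "\<dots> \<le> card (loops w) * (2 * r * K)"
    using card_bad_partners[OF w]
    by (intro sum_bounded_above[of _ _ "2 * r * K", simplified]) (auto simp: loops_def)
  finally show ?thesis by (simp add: card_loops)
qed

text \<open>An extra loop \<open>(s, q)\<close> determines \<open>s\<close>; then \<open>s'\<close>
  ranges over a block and \<open>u\<close> over the occurrences of the letter
  \<open>w s\<close>.\<close>

lemma card_switchings_double:
  assumes w: "w \<in> words"
  shows "card {(s, s', u). (s, s', u) \<in> switchings \<and> w s = w u \<and> loops_at w s \<noteq> {}}
    \<le> 2 * nloops w * (r * K)"
proof -
  let ?S = "SIGMA p:loops w. {s' \<in> slots. fst s' = fst (fst p)} \<times> {u \<in> slots. w u = w (fst p)}"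
  have "{(s, s', u). (s, s', u) \<in> switchings \<and> w s = w u \<and> loops_at w s \<noteq> {}}
      \<subseteq> (\<lambda>((s, q), s', u). (s, s', u)) ` ?S"
  proof (rule subsetI)
    fix x assume "x \<in> {(s, s', u). (s, s', u) \<in> switchings \<and> w s = w u \<and> loops_at w s \<noteq> {}}"
    then obtain s s' u q where x: "x = (s, s', u)" "(s, s', u) \<in> switchings" "w s = w u"
        and "q \<in> loops_at w s"
      by blast
    then have "((s, q), s', u) \<in> ?S" by (auto simp: switchings_def loops_def loops_at_def)
    then show "x \<in> (\<lambda>((s, q), s', u). (s, s', u)) ` ?S" using x(1) by force
  qed
  then have "card {(s, s', u). (s, s', u) \<in> switchings \<and> w s = w u \<and> loops_at w s \<noteq> {}} \<le> card ?S"
    by (rule surj_card_le[rotated]) auto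
  also have "\<dots> = (\<Sum>p\<in>loops w. card {s' \<in> slots. fst s' = fst (fst p)} * card {u \<in> slots. w u = w (fst p)})"
    by (simp add: card_cartesian_product)
  also have "\<dots> \<le> card (loops w) * (r * K)"
  proof (rule sum_bounded_above[of _ _ "r * K", simplified])
    fix p assume "p \<in> loops w"
    then have "fst p \<in> slots" by (auto simp: loops_def)
    then show "card {s' \<in> slots. fst s' = fst (fst p)} * card {u \<in> slots. w u = w (fst p)} \<le> r * K"
      using card_letter_le[OF w] by (simp add: card_block_slot)
  qed
  finally show ?thesis by (simp add: card_loops)
qed

text \<open>
  The swap of \<open>s'\<close> and \<open>u\<close> is an involution exchanging the words with the loop \<open>{s, s'}\<close> and those
  with \<open>w s = w u\<close>. The loop count changes by exactly one unless the swap creates a loop (first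
  error sum) or its inverse does so besides \<open>{s, s'}\<close> (second error sum).
\<close>

lemma switching_term:
  fixes x :: real
  assumes x: "0 \<le> x" "x \<le> 1" and \<tau>: "(s, s', u) \<in> switchings"
  shows "\<bar>(\<Sum>w\<in>{w\<in>words. w s = w s'}. x ^ (nloops w - 1)) - (\<Sum>w\<in>{w\<in>words. w s = w u}. x ^ nloops w)\<bar>
    \<le> (\<Sum>w\<in>{w\<in>words. w s = w s' \<and> u \<in> bad_partners w s'}. x ^ (nloops w - 1))
     + (\<Sum>w\<in>{w\<in>words. w s = w u \<and> (loops_at w s \<noteq> {} \<or>
          (\<exists>q\<in>{q\<in>slots. fst q = fst u \<and> q \<noteq> u}. w s' = w q))}. x ^ nloops w)"
proof -
  define g where "g w = w \<circ> transpose s' u" for w :: "nat \<times> nat \<Rightarrow> 'a"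
  \<comment> \<open>\<open>C\<close> describes when the inverse swap creates a further loop, so
    below it is tested on the swapped word \<open>g w\<close>.\<close>
  define C where "C w \<longleftrightarrow> loops_at w s \<noteq> {} \<or> (\<exists>q\<in>{q\<in>slots. fst q = fst u \<and> q \<noteq> u}. w s' = w q)"
    for w :: "nat \<times> nat \<Rightarrow> 'a"
  have sl: "s \<in> slots" "s' \<in> slots" "u \<in> slots" "s \<noteq> s'" "fst s = fst s'" "fst s' \<noteq> fst u"
    using \<tau> by (auto simp: switchings_def)
  then have su: "s \<noteq> u" "s' \<noteq> u" by auto
  have gg: "g (g w) = w" for w by (simp add: g_def)
  have gw: "w \<in> words \<Longrightarrow> g w \<in> words" for w by (simp add: g_def words_transpose sl)
  have gs: "g w s = w s" "g w s' = w u" "g w u = w s'" for w using sl su by (auto simp: g_def)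
  have reindex: "(\<Sum>w\<in>{w\<in>words. w s = w u \<and> Q w}. x ^ nloops w)
      = (\<Sum>w\<in>{w\<in>words. w s = w s' \<and> Q (g w)}. x ^ nloops (g w))" for Q
    by (rule sum.reindex_bij_witness[of _ g g]) (auto simp: gg gw gs)
  have pointwise: "\<bar>x ^ (nloops w - 1) - x ^ nloops (g w)\<bar>
      \<le> (if u \<in> bad_partners w s' then x ^ (nloops w - 1) else 0) + (if C (g w) then x ^ nloops (g w) else 0)"
    if w: "w \<in> words" "w s = w s'" for w
  proof -
    have eq: "nloops (g w) + card (loops_at w s') + card (loops_at w u)
        = nloops w + card (loops_at (g w) s') + card (loops_at (g w) u)"
      unfolding g_def by (rule nloops_transpose) (use sl in auto)
    have s_in: "s \<in> loops_at w s'" using sl w by (auto simp: loops_at_def)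
    then have ge: "1 \<le> card (loops_at w s')" by (auto simp: Suc_le_eq card_gt_0_iff)
    have le: "nloops (g w) \<le> nloops w - 1" if "u \<notin> bad_partners w s'"
    proof -
      have "loops_at (g w) s' = {}" "loops_at (g w) u = {}"
        using that sl by (auto simp: bad_partners_def g_def)
      with eq ge show ?thesis by simp
    qed
    \<comment> \<open>If \<open>C (g w)\<close> fails, then in \<open>w\<close> the only loop
      partner of \<open>s'\<close> is \<open>s\<close> and \<open>u\<close> has none, so the swap
      destroys just one loop.\<close>
    have ge': "nloops w - 1 \<le> nloops (g w)" if "\<not> C (g w)"
    proof -
      have "loops_at w s' \<subseteq> {s}"
      proof
        fix q assume q: "q \<in> loops_at w s'"
        then have "q \<noteq> s'" "q \<noteq> u" "w q = w s" using sl w by (auto simp: loops_at_def)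
        then have "g w q = g w s" using sl su by (simp add: g_def)
        then have "q \<in> loops_at (g w) s" if "q \<noteq> s" using that q sl by (auto simp: loops_at_def)
        with \<open>\<not> C (g w)\<close> show "q \<in> {s}" by (auto simp: C_def)
      qed
      then have "loops_at w s' = {s}" using s_in by blast
      moreover have "loops_at w u = {}"
      proof (rule ccontr)
        assume "loops_at w u \<noteq> {}"
        then obtain q where q: "q \<in> loops_at w u" by blast
        then have "q \<noteq> s'" "q \<noteq> u" using sl by (auto simp: loops_at_def)
        then have "g w q = w u" using q by (simp add: g_def loops_at_def)
        then have "g w s' = g w q" by (simp only: gs)
        with q \<open>q \<noteq> u\<close> have "C (g w)" unfolding C_def loops_at_def by blast
        with that show False by simp
      qed
      ultimately show ?thesis using eq by simp
    qed
    have nn: "0 \<le> x ^ (nloops w - 1)" "0 \<le> x ^ nloops (g w)" using x by auto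
    have "u \<notin> bad_partners w s' \<Longrightarrow> x ^ (nloops w - 1) \<le> x ^ nloops (g w)"
      using le x by (intro power_decreasing) auto
    moreover have "\<not> C (g w) \<Longrightarrow> x ^ nloops (g w) \<le> x ^ (nloops w - 1)"
      using ge' x by (intro power_decreasing) auto
    ultimately show ?thesis using nn by (auto simp: abs_if)
  qed
  have "(\<Sum>w\<in>{w\<in>words. w s = w s'}. x ^ (nloops w - 1)) - (\<Sum>w\<in>{w\<in>words. w s = w u}. x ^ nloops w)
      = (\<Sum>w\<in>{w\<in>words. w s = w s'}. x ^ (nloops w - 1) - x ^ nloops (g w))"
    using reindex[of "\<lambda>_. True"] by (simp add: sum_subtractf)
  also have "\<bar>\<dots>\<bar> \<le> (\<Sum>w\<in>{w\<in>words. w s = w s'}. \<bar>x ^ (nloops w - 1) - x ^ nloops (g w)\<bar>)"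
    by (rule sum_abs)
  also have "\<dots> \<le> (\<Sum>w\<in>{w\<in>words. w s = w s'}. (if u \<in> bad_partners w s' then x ^ (nloops w - 1) else 0)
      + (if C (g w) then x ^ nloops (g w) else 0))"
    by (intro sum_mono pointwise) auto
  also have "\<dots> = (\<Sum>w\<in>{w\<in>words. w s = w s' \<and> u \<in> bad_partners w s'}. x ^ (nloops w - 1))
      + (\<Sum>w\<in>{w\<in>words. w s = w s' \<and> C (g w)}. x ^ nloops (g w))"
    by (simp add: sum.distrib sum.inter_filter[symmetric] conj_assoc)
  also have "(\<Sum>w\<in>{w\<in>words. w s = w s' \<and> C (g w)}. x ^ nloops (g w))
      = (\<Sum>w\<in>{w\<in>words. w s = w u \<and> C w}. x ^ nloops w)"
    by (rule reindex[symmetric])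
  finally show ?thesis unfolding C_def .
qed

text \<open>The two coincidences \<open>w s = w u\<close> and \<open>w s' = w q\<close> together
  cost a factor \<open>(2 * K / (m * r)) ^ 2\<close>, against at most \<open>(m * r) ^ 2 * r\<close>
  triples and \<open>r\<close> choices of \<open>q\<close>.\<close>

lemma shared_pair_sum:
  assumes x: "0 \<le> x" "x \<le> 1" and K: "0 < K" and M: "8 * r * K \<le> m * r"
  shows "(\<Sum>(s, s', u)\<in>switchings. \<Sum>w\<in>{w\<in>words. w s = w u \<and>
        (\<exists>q\<in>{q\<in>slots. fst q = fst u \<and> q \<noteq> u}. w s' = w q)}. x ^ nloops w)
    \<le> 4 * (real r)\<^sup>2 * (real K)\<^sup>2 * loop_poly x"
proof (cases "m * r = 0")
  case True
  then have "slots = {}" by (auto simp: slots_def)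
  then have "switchings = {}" by (auto simp: switchings_def)
  then show ?thesis using loop_poly_nonneg[OF x(1)] by simp
next
  case False
  define c where "c = 2 * real K / (real m * real r)"
  have c: "0 \<le> c" by (simp add: c_def)
  have *: "(\<Sum>w\<in>{w\<in>words. w s = w u \<and> (\<exists>q\<in>{q\<in>slots. fst q = fst u \<and> q \<noteq> u}. w s' = w q)}. x ^ nloops w)
      \<le> r * (c\<^sup>2 * loop_poly x)" if \<tau>: "(s, s', u) \<in> switchings" for s s' u
  proof -
    let ?Q = "{q\<in>slots. fst q = fst u \<and> q \<noteq> u}"
    have sl: "s \<in> slots" "s' \<in> slots" "u \<in> slots" "s \<noteq> s'" "fst s = fst s'" "fst s' \<noteq> fst u"
      using \<tau> by (auto simp: switchings_def)
    have "(\<Sum>w\<in>{w\<in>words. w s = w u \<and> (\<exists>q\<in>?Q. w s' = w q)}. x ^ nloops w)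
        = (\<Sum>w\<in>{w\<in>words. \<exists>q\<in>?Q. w s' = w q \<and> w s = w u}. x ^ nloops w)"
      by (rule sum.cong) auto
    also have "\<dots> \<le> (\<Sum>q\<in>?Q. \<Sum>w\<in>{w\<in>words. w s' = w q \<and> w s = w u}. x ^ nloops w)"
      using x by (intro sum_Collect_bex_le) auto
    also have "\<dots> \<le> (\<Sum>q\<in>?Q. c\<^sup>2 * loop_poly x)"
    proof (rule sum_mono)
      fix q assume q: "q \<in> ?Q"
      \<comment> \<open>The condition \<open>w s = w u\<close> survives the swaps of
        \<open>s'\<close> with slots outside the blocks of \<open>s'\<close> and \<open>q\<close>,
        because \<open>s\<close> and \<open>u\<close> lie in these blocks.\<close>
      have "(\<Sum>w\<in>{w\<in>words. w s' = w q \<and> w s = w u}. x ^ nloops w)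
          \<le> c * (\<Sum>w\<in>{w\<in>words. w s = w u}. x ^ nloops w)"
        using coincidence_unlikely[of x s' q "\<lambda>w. w s = w u"] x K M q sl
        by (fastforce simp: c_def transpose_def)
      also have "(\<Sum>w\<in>{w\<in>words. w s = w u}. x ^ nloops w) \<le> c * loop_poly x"
        using coincidence_unlikely[of x s u "\<lambda>w. True"] x K M sl
        by (auto simp: c_def loop_poly_def)
      finally show "(\<Sum>w\<in>{w\<in>words. w s' = w q \<and> w s = w u}. x ^ nloops w) \<le> c\<^sup>2 * loop_poly x"
        using c by (simp add: power2_eq_square mult_left_mono mult.assoc)
    qed
    also have "\<dots> = card ?Q * (c\<^sup>2 * loop_poly x)" by simp
    also have "card ?Q \<le> card {q\<in>slots. fst q = fst u}" by (rule card_mono) auto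
    also have "\<dots> = r" by (rule card_block_slot) (rule sl)
    finally show ?thesis using c loop_poly_nonneg[OF x(1)] by (simp add: mult_right_mono)
  qed
  have "(\<Sum>(s, s', u)\<in>switchings. \<Sum>w\<in>{w\<in>words. w s = w u \<and>
        (\<exists>q\<in>{q\<in>slots. fst q = fst u \<and> q \<noteq> u}. w s' = w q)}. x ^ nloops w)
      \<le> (\<Sum>(s, s', u)\<in>switchings. r * (c\<^sup>2 * loop_poly x))"
    by (intro sum_mono) (use * in auto)
  also have "\<dots> = card switchings * (r * (c\<^sup>2 * loop_poly x))" by (simp add: case_prod_unfold)
  also have "\<dots> \<le> real ((m * r)\<^sup>2 * r) * (r * (c\<^sup>2 * loop_poly x))"
    using card_switchings_le loop_poly_nonneg[OF x(1)] by (intro mult_right_mono of_nat_mono) auto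
  also have "\<dots> = 4 * (real r)\<^sup>2 * (real K)\<^sup>2 * loop_poly x"
    using False by (simp add: c_def field_simps power2_eq_square)
  finally show ?thesis .
qed

text \<open>Summing \<open>switching_term\<close> over all triples compares
  \<open>2 * (m * r - r)\<close> times the derivative with \<open>r - 1\<close> times the weighted
  number of cross coincidences. The constant 10 collects 4 from \<open>e1\<close>, 2 from
  \<open>e2\<close>, and 2 each for replacing \<open>m * r - r\<close> by \<open>m * r\<close> and
  for dropping \<open>2 * L\<close>.\<close>

lemma loop_poly_deriv_switching:
  fixes x :: real
  assumes x: "0 \<le> x" "x \<le> 1" and K: "0 < K" and M: "8 * r * K \<le> m * r" and r: "0 < r"
  shows "\<bar>2 * real (m * r) * loop_poly_deriv x - real (r - 1) * real M2 * loop_poly x\<bar>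
    \<le> 10 * real r * real K * loop_poly_deriv x + 4 * (real r)\<^sup>2 * (real K)\<^sup>2 * loop_poly x"
proof -
  \<comment> \<open>\<open>L\<close> is \<open>x\<close> times the derivative. It enters because
    loops are subtracted from \<open>M2\<close> in the count of cross coincidences.\<close>
  define L where "L = (\<Sum>w\<in>words. real (nloops w) * x ^ nloops w)"
  have L: "0 \<le> L" "L \<le> loop_poly_deriv x"
    using x sum_nloops_le_Z' by (auto simp: L_def intro!: sum_nonneg)
  have "m \<noteq> 0" using K M r by auto
  then have rM: "real (m * r - r) = real (m * r) - real r" by (cases m) auto
  let ?F = "\<lambda>w. x ^ (nloops w - 1)" and ?G = "\<lambda>w. x ^ nloops w"
  let ?D = "\<lambda>s s' u w. \<exists>q\<in>{q\<in>slots. fst q = fst u \<and> q \<noteq> u}. w s' = w q"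
  have fwd: "(\<Sum>(s, s', u)\<in>switchings. \<Sum>w\<in>{w\<in>words. w s = w s'}. ?F w)
      = 2 * (real (m * r) - r) * loop_poly_deriv x"
  proof -
    have "real (2 * nloops w * (m * r - r)) * ?F w = 2 * (real (m * r) - r) * (real (nloops w) * ?F w)" for w
      using rM by simp
    then show ?thesis by (simp only: sum_switchings card_switchings_loop loop_poly_deriv_def sum_distrib_left)
  qed
  have bwd: "(\<Sum>(s, s', u)\<in>switchings. \<Sum>w\<in>{w\<in>words. w s = w u}. ?G w)
      = real (r - 1) * (real M2 * loop_poly x - 2 * L)"
  proof -
    have "real (card {(s, s', u). (s, s', u) \<in> switchings \<and> w s = w u}) * ?G w
        = real (r - 1) * (real M2 * ?G w - 2 * (real (nloops w) * ?G w))" if w: "w \<in> words" for w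
    proof -
      have "2 * nloops w \<le> M2" using card_cross[OF w] by linarith
      then have "real ((M2 - 2 * nloops w) * (r - 1)) = real (r - 1) * (real M2 - 2 * real (nloops w))"
        by (simp add: of_nat_diff)
      then show ?thesis unfolding card_switchings_cross[OF w] by (simp add: left_diff_distrib right_diff_distrib)
    qed
    then have "(\<Sum>(s, s', u)\<in>switchings. \<Sum>w\<in>{w\<in>words. w s = w u}. ?G w)
        = (\<Sum>w\<in>words. real (r - 1) * (real M2 * ?G w - 2 * (real (nloops w) * ?G w)))"
      unfolding sum_switchings by (intro sum.cong) auto
    then show ?thesis
      by (simp only: sum_subtractf sum_distrib_left[symmetric] L_def[symmetric] loop_poly_def[symmetric])
  qed
  have e1: "(\<Sum>(s, s', u)\<in>switchings. \<Sum>w\<in>{w\<in>words. w s = w s' \<and> u \<in> bad_partners w s'}. ?F w)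
      \<le> 4 * r * K * loop_poly_deriv x"
  proof -
    have "real (card {(s, s', u). (s, s', u) \<in> switchings \<and> w s = w s' \<and> u \<in> bad_partners w s'}) * ?F w
        \<le> 4 * real r * real K * (real (nloops w) * ?F w)" if "w \<in> words" for w
    proof -
      have "real (card {(s, s', u). (s, s', u) \<in> switchings \<and> w s = w s' \<and> u \<in> bad_partners w s'}) * ?F w
        \<le> real (2 * nloops w * (2 * r * K)) * ?F w"
        using x that card_switchings_bad by (intro mult_right_mono of_nat_mono) auto
      then show ?thesis by (simp add: mult_ac)
    qed
    then show ?thesis unfolding sum_switchings loop_poly_deriv_def sum_distrib_left by (intro sum_mono) simp
  qed
  have e2: "(\<Sum>(s, s', u)\<in>switchings. \<Sum>w\<in>{w\<in>words. w s = w u \<and> loops_at w s \<noteq> {}}. ?G w)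
      \<le> 2 * r * K * L"
  proof -
    have "real (card {(s, s', u). (s, s', u) \<in> switchings \<and> w s = w u \<and> loops_at w s \<noteq> {}}) * ?G w
        \<le> 2 * real r * real K * (real (nloops w) * ?G w)" if "w \<in> words" for w
    proof -
      have "real (card {(s, s', u). (s, s', u) \<in> switchings \<and> w s = w u \<and> loops_at w s \<noteq> {}}) * ?G w
        \<le> real (2 * nloops w * (r * K)) * ?G w"
        using x that card_switchings_double by (intro mult_right_mono of_nat_mono) auto
      then show ?thesis by (simp add: mult_ac)
    qed
    then show ?thesis unfolding sum_switchings L_def sum_distrib_left by (intro sum_mono) simp
  qed
  have e3: "(\<Sum>(s, s', u)\<in>switchings. \<Sum>w\<in>{w\<in>words. w s = w u \<and> ?D s s' u w}. ?G w)
      \<le> 4 * (real r)\<^sup>2 * (real K)\<^sup>2 * loop_poly x"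
    by (rule shared_pair_sum) fact+
  have "\<bar>2 * (real (m * r) - r) * loop_poly_deriv x - real (r - 1) * (real M2 * loop_poly x - 2 * L)\<bar>
      \<le> (\<Sum>(s, s', u)\<in>switchings.
          \<bar>(\<Sum>w\<in>{w\<in>words. w s = w s'}. ?F w) - (\<Sum>w\<in>{w\<in>words. w s = w u}. ?G w)\<bar>)"
    unfolding fwd[symmetric] bwd[symmetric] by (simp only: sum_subtractf[symmetric] case_prod_unfold sum_abs)
  also have "\<dots> \<le> (\<Sum>(s, s', u)\<in>switchings.
      (\<Sum>w\<in>{w\<in>words. w s = w s' \<and> u \<in> bad_partners w s'}. ?F w)
      + ((\<Sum>w\<in>{w\<in>words. w s = w u \<and> loops_at w s \<noteq> {}}. ?G w)
      + (\<Sum>w\<in>{w\<in>words. w s = w u \<and> ?D s s' u w}. ?G w)))"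
  proof (intro sum_mono, clarify)
    fix a b a' b' c d assume \<tau>: "((a, b), (a', b'), (c, d)) \<in> switchings"
    define s s' u where "s = (a, b)" and "s' = (a', b')" and "u = (c, d)"
    have "(\<Sum>w\<in>{w\<in>words. w s = w u \<and> (loops_at w s \<noteq> {} \<or> ?D s s' u w)}. ?G w)
      = (\<Sum>w\<in>{w\<in>words. w s = w u \<and> loops_at w s \<noteq> {} \<or> w s = w u \<and> ?D s s' u w}. ?G w)"
      by (rule sum.cong) auto
    also have "\<dots> \<le> (\<Sum>w\<in>{w\<in>words. w s = w u \<and> loops_at w s \<noteq> {}}. ?G w)
      + (\<Sum>w\<in>{w\<in>words. w s = w u \<and> ?D s s' u w}. ?G w)"
      using x by (intro sum_Collect_disj_le) auto
    finally show "\<bar>(\<Sum>w\<in>{w\<in>words. w (a, b) = w (a', b')}. ?F w) - (\<Sum>w\<in>{w\<in>words. w (a, b) = w (c, d)}. ?G w)\<bar>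
      \<le> (\<Sum>w\<in>{w\<in>words. w (a, b) = w (a', b') \<and> (c, d) \<in> bad_partners w (a', b')}. ?F w)
      + ((\<Sum>w\<in>{w\<in>words. w (a, b) = w (c, d) \<and> loops_at w (a, b) \<noteq> {}}. ?G w)
      + (\<Sum>w\<in>{w\<in>words. w (a, b) = w (c, d) \<and> ?D (a, b) (a', b') (c, d) w}. ?G w))"
      using switching_term[OF x \<tau>] unfolding s_def s'_def u_def by linarith
  qed
  also have "\<dots> \<le> 4 * r * K * loop_poly_deriv x + (2 * r * K * L + 4 * (real r)\<^sup>2 * (real K)\<^sup>2 * loop_poly x)"
    using e1 e2 e3 unfolding case_prod_unfold sum.distrib by linarith
  finally have main: "\<bar>2 * (real (m * r) - r) * loop_poly_deriv x - real (r - 1) * (real M2 * loop_poly x - 2 * L)\<bar>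
      \<le> 4 * r * K * loop_poly_deriv x + (2 * r * K * L + 4 * (real r)\<^sup>2 * (real K)\<^sup>2 * loop_poly x)" .
  have "r * K * L \<le> r * K * loop_poly_deriv x" using L by (intro mult_left_mono) auto
  moreover have "0 \<le> real (r - 1) * L" "real (r - 1) * L \<le> r * loop_poly_deriv x"
    using L by (auto intro!: mult_mono)
  moreover have "0 \<le> r * loop_poly_deriv x" "r * loop_poly_deriv x \<le> r * K * loop_poly_deriv x"
    using K L by (auto simp: mult_le_cancel_left1 mult_le_cancel_right1 mult_right_mono)
  ultimately show ?thesis using main unfolding abs_le_iff by (simp add: algebra_simps)
qed

subsection \<open>Loop-free and simple words\<close>

text \<open>With \<open>m * r - 1\<close> in place of \<open>m * r\<close>, this would be the mean
  number of loops of a uniformly random word.\<close>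

definition expected_loops :: real where
  "expected_loops = real (r - 1) * real M2 / (2 * real (m * r))"

lemma M2_le: "M2 \<le> m * r * K"
proof -
  have "M2 \<le> (\<Sum>a\<in>set_mset A. count A a * K)"
    unfolding M2_def using count_le by (intro sum_mono mult_left_mono) (auto intro: le_diff_conv[THEN iffD2] trans_le_add1)
  also have "\<dots> = size A * K" by (simp add: size_multiset_overloaded_eq sum_distrib_right)
  finally show ?thesis by (simp add: size_A)
qed

text \<open>The switching inequality has the derivative on its right-hand side too. A crude first
  use bounds it by \<open>2 * c * loop_poly x\<close>; substituting this gives the error
  \<open>(10 * 2 + 4) * c ^ 2\<close>, and division by \<open>2 * N\<close> gives the constant
  12.\<close>

lemma loop_poly_deriv_estimate:
  assumes x: "0 \<le> x" "x \<le> 1" and K: "0 < K" and M: "10 * r * K \<le> m * r" and r: "0 < r"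
  shows "\<bar>loop_poly_deriv x - expected_loops * loop_poly x\<bar> \<le> 12 * (real r * real K)\<^sup>2 / real (m * r) * loop_poly x"
proof -
  define N where "N = real (m * r)"
  define c where "c = real r * real K"
  have c: "10 * c \<le> N" "1 \<le> c"
  proof -
    have "real (10 * r * K) \<le> N" unfolding N_def using M by (rule of_nat_mono)
    then show "10 * c \<le> N" by (simp add: c_def)
    have "1 \<le> r * K" using r K by (simp add: Suc_le_eq)
    then have "1 \<le> real (r * K)" by linarith
    then show "1 \<le> c" by (simp add: c_def)
  qed
  then have N: "0 < N" by linarith
  have Zs: "0 \<le> loop_poly x" "0 \<le> loop_poly_deriv x" using x by (auto simp: loop_poly_nonneg loop_poly_deriv_nonneg)
  have sw: "\<bar>2 * N * loop_poly_deriv x - real (r - 1) * real M2 * loop_poly x\<bar> \<le> 10 * c * loop_poly_deriv x + 4 * c\<^sup>2 * loop_poly x"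
    using loop_poly_deriv_switching[of x] x K M r by (simp add: N_def c_def power_mult_distrib mult.assoc)
  have "real M2 \<le> N * K" unfolding N_def using M2_le by (metis of_nat_mono of_nat_mult)
  then have "real (r - 1) * real M2 \<le> r * (N * K)" by (intro mult_mono) auto
  then have "real (r - 1) * real M2 * loop_poly x \<le> c * N * loop_poly x"
    using Zs by (intro mult_right_mono) (simp_all add: c_def mult_ac)
  \<comment> \<open>By \<open>10 * r * K \<le> m * r\<close>, half of the term
    \<open>2 * N * loop_poly_deriv x\<close> absorbs this error.\<close>
  moreover have "10 * c * loop_poly_deriv x \<le> N * loop_poly_deriv x" using c Zs by (intro mult_right_mono) auto
  moreover have "4 * c\<^sup>2 * loop_poly x \<le> c * N * loop_poly x"
  proof -
    have "4 * c * c \<le> N * c" using c by (intro mult_right_mono) auto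
    then have "4 * c\<^sup>2 \<le> c * N" by (simp add: power2_eq_square mult_ac)
    then show ?thesis using Zs by (intro mult_right_mono) auto
  qed
  ultimately have "N * loop_poly_deriv x \<le> N * (2 * c * loop_poly x)"
    using sw by (simp add: algebra_simps abs_le_iff)
  then have "loop_poly_deriv x \<le> 2 * c * loop_poly x" using N by simp
  then have "10 * c * loop_poly_deriv x \<le> 10 * c * (2 * c * loop_poly x)" using c by (intro mult_left_mono) auto
  then have "\<bar>2 * N * loop_poly_deriv x - real (r - 1) * real M2 * loop_poly x\<bar> \<le> 24 * c\<^sup>2 * loop_poly x"
    using sw by (simp add: power2_eq_square)
  moreover have "2 * N * loop_poly_deriv x - real (r - 1) * real M2 * loop_poly x = 2 * N * (loop_poly_deriv x - expected_loops * loop_poly x)"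
    using N by (simp add: expected_loops_def N_def[symmetric] algebra_simps del: of_nat_mult)
  ultimately have "2 * N * \<bar>loop_poly_deriv x - expected_loops * loop_poly x\<bar> \<le> 24 * c\<^sup>2 * loop_poly x"
    using N by (simp add: abs_mult)
  then show ?thesis using N unfolding N_def[symmetric] c_def[symmetric]
    by (simp add: field_simps)
qed

section \<open>Integration over the unit interval\<close>

lemma loop_poly_has_derivative: "(loop_poly has_real_derivative loop_poly_deriv x) (at x)"
  unfolding loop_poly_def[abs_def] loop_poly_deriv_def by (auto intro!: derivative_eq_intros sum.cong)

text \<open>A Gronwall argument: multiplied by \<open>exp (- (c * x))\<close> with
  \<open>c = expected_loops + E\<close> or \<open>c = expected_loops - E\<close>, the polynomial is
  monotone on the unit interval. This avoids dividing by \<open>loop_poly x\<close>.\<close>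

lemma loop_poly_0_bounds:
  assumes K: "0 < K" and M: "10 * r * K \<le> m * r" and r: "0 < r"
  defines "E \<equiv> 12 * (real r * real K)\<^sup>2 / real (m * r)"
  shows "loop_poly 1 * exp (- expected_loops - E) \<le> loop_poly 0" "loop_poly 0 \<le> loop_poly 1 * exp (- expected_loops + E)"
proof -
  let ?f = "\<lambda>c x. loop_poly x * exp (- (c * x))"
  have d: "(?f c has_real_derivative (loop_poly_deriv x - c * loop_poly x) * exp (- (c * x))) (at x)" for c x
    by (auto intro!: derivative_eq_intros loop_poly_has_derivative simp: algebra_simps)
  note est = loop_poly_deriv_estimate[OF _ _ K M r, folded E_def]
  have "?f (expected_loops + E) 1 \<le> ?f (expected_loops + E) 0"
  proof (rule DERIV_nonpos_imp_nonincreasing[of 0 1])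
    fix x :: real assume "0 \<le> x" "x \<le> 1"
    with est[of x] have "loop_poly_deriv x - (expected_loops + E) * loop_poly x \<le> 0"
      by (simp add: abs_le_iff algebra_simps)
    then show "\<exists>y. (?f (expected_loops + E) has_real_derivative y) (at x) \<and> y \<le> 0"
      using d by (intro exI conjI) (auto intro: mult_nonpos_nonneg)
  qed simp
  then show "loop_poly 1 * exp (- expected_loops - E) \<le> loop_poly 0" by simp
  have "?f (expected_loops - E) 0 \<le> ?f (expected_loops - E) 1"
  proof (rule DERIV_nonneg_imp_nondecreasing[of 0 1])
    fix x :: real assume "0 \<le> x" "x \<le> 1"
    with est[of x] have "0 \<le> loop_poly_deriv x - (expected_loops - E) * loop_poly x"
      by (simp add: abs_le_iff algebra_simps)
    then show "\<exists>y. (?f (expected_loops - E) has_real_derivative y) (at x) \<and> 0 \<le> y"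
      using d by (intro exI conjI) auto
  qed simp
  then show "loop_poly 0 \<le> loop_poly 1 * exp (- expected_loops + E)" by simp
qed

text \<open>At \<open>x = 0\<close> the weight is the indicator of loop-freeness, so
  \<open>coincidence_unlikely\<close> becomes a statement about loop-free words.\<close>

lemma sum_0_power_nloops:
  "(\<Sum>w\<in>{w\<in>words. P w}. 0 ^ nloops w) = real (card {w\<in>words. P w \<and> nloops w = 0})"
proof -
  have "(\<Sum>w\<in>{w\<in>words. P w}. 0 ^ nloops w) = (\<Sum>w\<in>{w\<in>words. P w}. if nloops w = 0 then 1 else (0::real))"
    by (rule sum.cong) auto
  also have "\<dots> = (\<Sum>w\<in>{w\<in>{w\<in>words. P w}. nloops w = 0}. 1)"
    by (rule sum.inter_filter[symmetric]) simp
  finally show ?thesis by (simp add: conj_assoc)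
qed

section \<open>Repeated edges among loop-free words\<close>

definition simple_words :: "(nat \<times> nat \<Rightarrow> 'a) set" where
  "simple_words = {w\<in>words. nloops w = 0 \<and> inj_on (block_edge r w) {..<m}}"

text \<open>If two blocks carry the same edge, the letters in positions 0, 1, 2 of one recur in the
  other; these positions exist as \<open>r\<close> is at least 3. At most
  \<open>m ^ 2 * r ^ 3\<close> choices of slots, times \<open>(2 * K / (m * r)) ^ 3\<close>, give
  the bound.\<close>

lemma card_repeated_edges:
  assumes r: "3 \<le> r" and K: "0 < K" and M: "8 * r * K \<le> m * r"
  shows "real (card {w\<in>words. nloops w = 0 \<and> \<not> inj_on (block_edge r w) {..<m}})
    \<le> 8 * real r * real K ^ 3 / real (m * r) * loop_poly 0"
proof -
  define T where "T = {((b, b'), j0, j1, j2). b < m \<and> b' < m \<and> b \<noteq> b' \<and> j0 < r \<and> j1 < r \<and> j2 < r}"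
  define c where "c = 2 * real K / (real m * real r)"
  have c: "0 \<le> c" by (simp add: c_def)
  have Z0: "0 \<le> loop_poly 0" by (simp add: loop_poly_nonneg)
  let ?R = "\<lambda>((b, b'), j0, j1, j2) w. w (b, 0) = w (b', j0) \<and> w (b, 1) = w (b', j1) \<and> w (b, 2) = w (b', j2)"
  let ?S = "{..<m} \<times> {..<m}" and ?J = "{..<r} \<times> {..<r} \<times> {..<r}"
  have Tsub: "T \<subseteq> ?S \<times> ?J" by (auto simp: T_def)
  then have Tfin: "finite T" by (rule finite_subset) auto
  have "card T \<le> m\<^sup>2 * r ^ 3"
    using card_mono[OF _ Tsub] by (simp add: card_cartesian_product power2_eq_square power3_eq_cube)
  then have Tcard: "real (card T) \<le> (real m)\<^sup>2 * real r ^ 3" by (metis of_nat_mono of_nat_mult of_nat_power)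
  have ex: "\<exists>\<tau>\<in>T. ?R \<tau> w" if ninj: "\<not> inj_on (block_edge r w) {..<m}" for w
  proof -
    obtain b b' where b: "b < m" "b' < m" "b \<noteq> b'" "block_edge r w b = block_edge r w b'"
      using ninj by (auto simp: inj_on_def)
    have "\<exists>j'<r. w (b, j) = w (b', j')" if "j < r" for j
    proof -
      have "w (b, j) \<in># block_edge r w b" using that by (simp add: block_edge_def)
      then have "w (b, j) \<in># block_edge r w b'" using b by simp
      then show ?thesis by (auto simp: block_edge_def)
    qed
    from this[of 0] this[of 1] this[of 2] r obtain j0 j1 j2
      where "j0 < r" "j1 < r" "j2 < r" "w (b, 0) = w (b', j0)" "w (b, 1) = w (b', j1)" "w (b, 2) = w (b', j2)"
      by (metis less_le_trans numeral_3_eq_3 numeral_2_eq_2 One_nat_def lessI less_SucI)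
    then show ?thesis using b by (intro bexI[of _ "((b, b'), j0, j1, j2)"]) (auto simp: T_def)
  qed
  have each: "(\<Sum>w\<in>{w\<in>words. ?R \<tau> w}. 0 ^ nloops w) \<le> c ^ 3 * loop_poly 0" if \<tau>T: "\<tau> \<in> T" for \<tau>
  proof -
    obtain b b' j0 j1 j2 where \<tau>: "\<tau> = ((b, b'), j0, j1, j2)" "b < m" "b' < m" "b \<noteq> b'" "j0 < r" "j1 < r" "j2 < r"
      using \<tau>T by (auto simp: T_def)
    have sl: "(b, 0) \<in> slots" "(b, 1) \<in> slots" "(b, 2) \<in> slots"
      "(b', j0) \<in> slots" "(b', j1) \<in> slots" "(b', j2) \<in> slots"
      using \<tau> r by (auto simp: slots_def)
    \<comment> \<open>The coincidences are peeled off one at a time: swapping an end of one with a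
      slot outside both blocks leaves the remaining ones intact.\<close>
    let ?P1 = "\<lambda>w. w (b, 1) = w (b', j1) \<and> w (b, 2) = w (b', j2)" and ?P2 = "\<lambda>w. w (b, 2) = w (b', j2)"
    have "(\<Sum>w\<in>{w\<in>words. w (b, 0) = w (b', j0) \<and> ?P1 w}. 0 ^ nloops w) \<le> c * (\<Sum>w\<in>{w\<in>words. ?P1 w}. 0 ^ nloops w)"
      using coincidence_unlikely[of 0 "(b, 0)" "(b', j0)" ?P1] sl K M \<tau>
      by (fastforce simp: c_def transpose_def)
    also have "(\<Sum>w\<in>{w\<in>words. ?P1 w}. 0 ^ nloops w) \<le> c * (\<Sum>w\<in>{w\<in>words. ?P2 w}. 0 ^ nloops w)"
      using coincidence_unlikely[of 0 "(b, 1)" "(b', j1)" ?P2] sl K M \<tau>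
      by (fastforce simp: c_def transpose_def)
    also have "(\<Sum>w\<in>{w\<in>words. ?P2 w}. 0 ^ nloops w) \<le> c * loop_poly 0"
      using coincidence_unlikely[of 0 "(b, 2)" "(b', j2)" "\<lambda>_. True"] sl K M \<tau>
      by (auto simp: c_def loop_poly_def)
    finally show ?thesis using c \<tau>(1) by (simp add: mult_left_mono power3_eq_cube mult.assoc)
  qed
  have "real (card {w\<in>words. nloops w = 0 \<and> \<not> inj_on (block_edge r w) {..<m}})
      \<le> real (card {w\<in>words. (\<exists>\<tau>\<in>T. ?R \<tau> w) \<and> nloops w = 0})"
    using ex by (intro of_nat_mono card_mono) auto
  also have "\<dots> = (\<Sum>w\<in>{w\<in>words. \<exists>\<tau>\<in>T. ?R \<tau> w}. 0 ^ nloops w)"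
    by (rule sum_0_power_nloops[symmetric])
  also have "\<dots> \<le> (\<Sum>\<tau>\<in>T. \<Sum>w\<in>{w\<in>words. ?R \<tau> w}. 0 ^ nloops w)"
    using Tfin by (intro sum_Collect_bex_le) auto
  also have "\<dots> \<le> (\<Sum>\<tau>\<in>T. c ^ 3 * loop_poly 0)" by (intro sum_mono each)
  also have "\<dots> = real (card T) * (c ^ 3 * loop_poly 0)" by simp
  also have "\<dots> \<le> ((real m)\<^sup>2 * real r ^ 3) * (c ^ 3 * loop_poly 0)"
    using Tcard c Z0 by (intro mult_right_mono) auto
  \<comment> \<open>For \<open>m = 0\<close> division by zero makes both sides 0.\<close>
  also have "\<dots> = 8 * real r * real K ^ 3 / real (m * r) * loop_poly 0"
    using r by (cases "m = 0") (simp_all add: c_def field_simps power2_eq_square power3_eq_cube)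
  finally show ?thesis .
qed

lemma simple_words_bounds:
  assumes r: "3 \<le> r" and K: "0 < K" and M: "10 * r * K \<le> m * r"
  shows "(1 - 8 * real r * real K ^ 3 / real (m * r)) * loop_poly 0 \<le> real (card simple_words)"
    and "real (card simple_words) \<le> loop_poly 0"
proof -
  have Z0: "loop_poly 0 = real (card {w\<in>words. nloops w = 0})"
    using sum_0_power_nloops[of "\<lambda>_. True"] by (simp add: loop_poly_def)
  have "{w\<in>words. nloops w = 0} = simple_words \<union> {w\<in>words. nloops w = 0 \<and> \<not> inj_on (block_edge r w) {..<m}}"
    by (auto simp: simple_words_def)
  also have "card \<dots> = card simple_words + card {w\<in>words. nloops w = 0 \<and> \<not> inj_on (block_edge r w) {..<m}}"
    by (rule card_Un_disjoint) (auto simp: simple_words_def)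
  finally have "loop_poly 0 = card simple_words + card {w\<in>words. nloops w = 0 \<and> \<not> inj_on (block_edge r w) {..<m}}"
    by (simp add: Z0)
  moreover have "8 * r * K \<le> m * r" using M by linarith
  ultimately show "(1 - 8 * real r * real K ^ 3 / real (m * r)) * loop_poly 0 \<le> real (card simple_words)"
    "real (card simple_words) \<le> loop_poly 0"
    using card_repeated_edges[OF r K] by (simp_all add: algebra_simps)
qed

end

subsection \<open>From words to hypergraphs\<close>

definition word_hypergraph :: "nat \<Rightarrow> nat \<Rightarrow> (nat \<times> nat \<Rightarrow> 'a) \<Rightarrow> 'a hypergraph" where
  "word_hypergraph m r w = image_mset (block_edge r w) (mset_set {..<m})"

lemma size_block_edge [simp]: "size (block_edge r w b) = r"
  by (simp add: block_edge_def)

lemma count_block_edge: "count (block_edge r w b) v = card {j \<in> {..<r}. w (b, j) = v}"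
  by (simp add: block_edge_def count_image_mset_set)

lemma count_word_hypergraph: "count (word_hypergraph m r w) e = card {b \<in> {..<m}. block_edge r w b = e}"
  by (simp add: word_hypergraph_def count_image_mset_set)

lemma vertex_degree_word_hypergraph:
  "vertex_degree (word_hypergraph m r w) v = card {s \<in> {..<m} \<times> {..<r}. w s = v}"
proof -
  have "vertex_degree (word_hypergraph m r w) v = (\<Sum>b<m. count (block_edge r w b) v)"
    by (simp add: vertex_degree_def word_hypergraph_def sum_unfold_sum_mset image_mset.compositionality comp_def)
  also have "\<dots> = card (SIGMA b:{..<m}. {j \<in> {..<r}. w (b, j) = v})"
    by (simp add: count_block_edge)
  also have "(SIGMA b:{..<m}. {j \<in> {..<r}. w (b, j) = v}) = {s \<in> {..<m} \<times> {..<r}. w s = v}"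
    by auto
  finally show ?thesis .
qed

lemma image_mset_restrict:
  "finite Y \<Longrightarrow> image_mset (restrict f Y) (mset_set Y) = image_mset f (mset_set Y)"
  by (intro image_mset_cong) auto

lemma card_arrangements_distinct:
  assumes "finite Y" "size A = card Y" "\<And>a. a \<in># A \<Longrightarrow> count A a = 1"
  shows "card (arrangements Y A) = fact (card Y)"
  using card_arrangements[OF assms(1,2)] assms(3) by (simp cong: prod.cong)

text \<open>A word with hypergraph \<open>H\<close> amounts to an order of the \<open>m\<close>
  distinct edges and, for each edge, an order of its \<open>r\<close> distinct vertices.\<close>

lemma card_word_hypergraph_fibre:
  assumes size: "size H = m" and unif: "\<And>e. e \<in># H \<Longrightarrow> size e = r"
    and loop: "\<And>e v. e \<in># H \<Longrightarrow> v \<in># e \<Longrightarrow> count e v = 1" and rep: "\<And>e. e \<in># H \<Longrightarrow> count H e = 1"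
  shows "card {w \<in> ({..<m} \<times> {..<r}) \<rightarrow>\<^sub>E UNIV. word_hypergraph m r w = H} = fact m * fact r ^ m"
proof -
  let ?S = "{w \<in> ({..<m} \<times> {..<r}) \<rightarrow>\<^sub>E UNIV. word_hypergraph m r w = H}"
  let ?\<Phi> = "\<lambda>g. \<Pi>\<^sub>E b\<in>{..<m}. arrangements {..<r} (g b)"
  let ?T = "SIGMA g:arrangements {..<m} H. ?\<Phi> g"
  define F where "F w = (restrict (block_edge r w) {..<m}, \<lambda>b\<in>{..<m}. \<lambda>j\<in>{..<r}. w (b, j))" for w :: "nat \<times> nat \<Rightarrow> 'a"
  define F' where "F' = (\<lambda>(g :: nat \<Rightarrow> 'a multiset, \<phi>). \<lambda>p\<in>{..<m} \<times> {..<r}. \<phi> (fst p) (snd p) :: 'a)"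
  have "bij_betw F ?S ?T"
  proof (rule bij_betw_byWitness[of _ F'])
    show "\<forall>w\<in>?S. F' (F w) = w"
    proof
      fix w assume "w \<in> ?S"
      then have "w \<in> extensional ({..<m} \<times> {..<r})" by (auto simp: PiE_def)
      then show "F' (F w) = w"
        by (intro extensionalityI[of _ "{..<m} \<times> {..<r}"]) (auto simp: F_def F'_def)
    qed
    have edge: "block_edge r (F' (g, \<phi>)) b = g b" if "\<phi> \<in> ?\<Phi> g" "b < m" for g \<phi> b
    proof -
      have "image_mset (\<phi> b) (mset_set {..<r}) = g b"
        using that by (auto dest: PiE_mem arrangementsD(2))
      moreover have "block_edge r (F' (g, \<phi>)) b = image_mset (\<phi> b) (mset_set {..<r})"
        unfolding block_edge_def F'_def using that(2) by (intro image_mset_cong) auto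
      ultimately show ?thesis by simp
    qed
    show "\<forall>p\<in>?T. F (F' p) = p"
    proof (clarify)
      fix g \<phi> assume g: "g \<in> arrangements {..<m} H" and \<phi>: "\<phi> \<in> ?\<Phi> g"
      have 1: "restrict (block_edge r (F' (g, \<phi>))) {..<m} = g"
        using arrangementsD(1)[OF g] edge[OF \<phi>] by (intro extensionalityI[of _ "{..<m}"]) auto
      have 2: "(\<lambda>b\<in>{..<m}. \<lambda>j\<in>{..<r}. F' (g, \<phi>) (b, j)) = \<phi>"
      proof (rule extensionalityI[of _ "{..<m}"])
        show "\<phi> \<in> extensional {..<m}" using \<phi> by (auto simp: PiE_def)
        fix b assume b: "b \<in> {..<m}"
        then have "\<phi> b \<in> extensional {..<r}" using \<phi> by (auto dest: PiE_mem arrangementsD(1))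
        then have "(\<lambda>j\<in>{..<r}. F' (g, \<phi>) (b, j)) = \<phi> b"
          using b by (intro extensionalityI[of _ "{..<r}"]) (auto simp: F'_def)
        then show "(\<lambda>b\<in>{..<m}. \<lambda>j\<in>{..<r}. F' (g, \<phi>) (b, j)) b = \<phi> b" using b by simp
      qed auto
      show "F (F' (g, \<phi>)) = (g, \<phi>)" by (simp only: F_def 1 2)
    qed
    show "F ` ?S \<subseteq> ?T"
    proof (rule image_subsetI)
      fix w assume "w \<in> ?S"
      then have "word_hypergraph m r w = H" by simp
      then have "restrict (block_edge r w) {..<m} \<in> arrangements {..<m} H"
        by (auto simp: arrangements_def word_hypergraph_def image_mset_restrict)
      moreover have "(\<lambda>b\<in>{..<m}. \<lambda>j\<in>{..<r}. w (b, j)) \<in> ?\<Phi> (restrict (block_edge r w) {..<m})"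
        by (auto simp: arrangements_def block_edge_def image_mset_restrict)
      ultimately show "F w \<in> ?T" by (simp add: F_def)
    qed
    show "F' ` ?T \<subseteq> ?S"
    proof (rule image_subsetI, clarify)
      fix g \<phi> assume g: "g \<in> arrangements {..<m} H" and \<phi>: "\<phi> \<in> ?\<Phi> g"
      have "word_hypergraph m r (F' (g, \<phi>)) = image_mset g (mset_set {..<m})"
        unfolding word_hypergraph_def using edge[OF \<phi>] by (intro image_mset_cong) auto
      then show "F' (g, \<phi>) \<in> {..<m} \<times> {..<r} \<rightarrow>\<^sub>E UNIV \<and> word_hypergraph m r (F' (g, \<phi>)) = H"
        using arrangementsD(2)[OF g] by (auto simp: F'_def)
    qed
  qed
  then have "card ?S = card ?T" by (rule bij_betw_same_card)
  also have "\<dots> = (\<Sum>g\<in>arrangements {..<m} H. card (?\<Phi> g))"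
    by (rule card_SigmaI) (auto intro!: finite_PiE finite_arrangements)
  also have "\<dots> = (\<Sum>g\<in>arrangements {..<m} H. fact r ^ m)"
  proof (rule sum.cong[OF refl])
    fix g assume g: "g \<in> arrangements {..<m} H"
    have "card (arrangements {..<r} (g b)) = fact r" if "b < m" for b
    proof -
      have "g b \<in># H" using arrangementsD(2)[OF g] that by auto
      then show ?thesis using card_arrangements_distinct[of "{..<r}" "g b"] unif loop by auto
    qed
    then show "card (?\<Phi> g) = fact r ^ m" by (simp add: card_PiE)
  qed
  also have "\<dots> = fact m * fact r ^ m"
    using card_arrangements_distinct[of "{..<m}" H] size rep by simp
  finally show ?thesis .
qed

section \<open>Words for a degree vector\<close>

definition degree_mset :: "nat \<Rightarrow> (nat \<Rightarrow> nat) \<Rightarrow> nat multiset" where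
  "degree_mset n k = (\<Sum>i=1..n. replicate_mset (k i) i)"

lemma count_degree_mset: "count (degree_mset n k) i = (if i \<in> {1..n} then k i else 0)"
proof -
  have "count (degree_mset n k) i = (\<Sum>j=1..n. if j = i then k i else 0)"
    by (auto simp: degree_mset_def count_sum intro!: sum.cong)
  then show ?thesis by simp
qed

lemma size_degree_mset: "size (degree_mset n k) = deg_sum n k"
proof -
  have "size (\<Sum>i\<in>I. replicate_mset (k i) i) = (\<Sum>i\<in>I. k i)" for I
    by (induction I rule: infinite_finite_induct) auto
  then show ?thesis by (simp add: degree_mset_def deg_sum_def)
qed

lemma set_degree_mset: "set_mset (degree_mset n k) = {i \<in> {1..n}. k i \<noteq> 0}"
  by (auto simp: set_mset_def count_degree_mset)

text \<open>Handshaking: the degrees sum to \<open>r\<close> times the number of edges.\<close>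

lemma size_simple_hypergraph:
  assumes H: "H \<in> simple_hypergraphs r n k" and M: "deg_sum n k = m * r" and r: "0 < r"
  shows "size H = m"
proof -
  have on: "\<And>e. e \<in># H \<Longrightarrow> set_mset e \<subseteq> {1..n}" and un: "\<And>e. e \<in># H \<Longrightarrow> size e = r"
    and deg: "\<And>i. i \<in> {1..n} \<Longrightarrow> vertex_degree H i = k i"
    using H by (auto simp: simple_hypergraphs_def hypergraph_on_def uniform_hypergraph_def)
  have swap: "(\<Sum>i=1..n. \<Sum>e\<in>#G. count e i) = (\<Sum>e\<in>#G. \<Sum>i=1..n. count e i)" for G :: "nat hypergraph"
    by (induction G) (simp_all add: sum.distrib)
  have "m * r = (\<Sum>i=1..n. vertex_degree H i)"
    using deg M by (simp add: deg_sum_def)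
  also have "\<dots> = (\<Sum>e\<in>#H. \<Sum>i=1..n. count e i)"
    by (simp only: vertex_degree_def swap)
  also have "\<dots> = (\<Sum>e\<in>#H. r)"
  proof (rule arg_cong[of _ _ sum_mset], rule image_mset_cong)
    fix e assume e: "e \<in># H"
    have "(\<Sum>i=1..n. count e i) = (\<Sum>i\<in>set_mset e. count e i)"
      using on[OF e] by (intro sum.mono_neutral_right) (auto simp: not_in_iff)
    then show "(\<Sum>i=1..n. count e i) = r" using un[OF e] by (simp add: size_multiset_overloaded_eq)
  qed
  finally show ?thesis using r by simp
qed

text \<open>\<open>word_hypergraph\<close> maps the simple words to the simple hypergraphs, and
  every fibre has the size found in \<open>card_word_hypergraph_fibre\<close>.\<close>

lemma card_simple_hypergraphs:
  assumes M: "deg_sum n k = m * r" and r: "0 < r" and K: "\<And>i. i \<in> {1..n} \<Longrightarrow> k i \<le> K"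
  shows "card (block_words.simple_words m r (degree_mset n k))
    = card (simple_hypergraphs r n k) * (fact m * fact r ^ m)"
proof -
  interpret block_words m r K "degree_mset n k"
    by unfold_locales (use M K in \<open>auto simp: size_degree_mset count_degree_mset\<close>)
  let ?h = "word_hypergraph m r"
  have to_simple: "?h w \<in> simple_hypergraphs r n k" if w: "w \<in> simple_words" for w
  proof -
    have ww: "w \<in> words" and nl: "nloops w = 0" and inj: "inj_on (block_edge r w) {..<m}"
      using w by (auto simp: simple_words_def)
    have "loops w = {}" using card_loops[of w] nl by simp
    then have no_loop: "j = j'" if "b < m" "j < r" "j' < r" "w (b, j) = w (b, j')" for b j j'
      using that by (fastforce simp: loops_def slots_def)
    have "count (block_edge r w b) v < 2" if "b < m" for b v
    proof -
      have "card {j \<in> {..<r}. w (b, j) = v} \<le> 1"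
        using no_loop[OF that] by (intro card_le_Suc0_iff_eq[THEN iffD2, folded One_nat_def]) auto
      then show ?thesis by (simp add: count_block_edge)
    qed
    moreover have "count (?h w) (block_edge r w b) = 1" if "b < m" for b
    proof -
      have "{b' \<in> {..<m}. block_edge r w b' = block_edge r w b} = {b}"
        using inj that by (auto simp: inj_on_def)
      then show ?thesis by (simp add: count_word_hypergraph)
    qed
    ultimately have "simple_hypergraph (?h w)"
      by (fastforce simp: simple_hypergraph_def is_loop_def word_hypergraph_def not_le)
    moreover have "hypergraph_on {1..n} (?h w)"
    proof -
      have "w (b, j) \<in> {1..n}" if "b < m" "j < r" for b j
        using letter_in[OF ww, of "(b, j)"] that by (auto simp: slots_def set_degree_mset)
      then show ?thesis by (auto simp: hypergraph_on_def word_hypergraph_def block_edge_def)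
    qed
    moreover have "uniform_hypergraph r (?h w)"
      by (auto simp: uniform_hypergraph_def word_hypergraph_def)
    moreover have "vertex_degree (?h w) i = k i" if "i \<in> {1..n}" for i
      using card_arrangements_fibre[OF ww, of i] that
      by (simp add: vertex_degree_word_hypergraph slots_def count_degree_mset)
    ultimately show ?thesis by (simp add: simple_hypergraphs_def)
  qed
  \<comment> \<open>Every word with hypergraph \<open>H\<close> is already simple: the degrees fix
    its letter counts, and the absence of loops and of repeated edges in \<open>H\<close> gives the
    other two conditions.\<close>
  have fibre: "{w \<in> simple_words. ?h w = H} = {w \<in> ({..<m} \<times> {..<r}) \<rightarrow>\<^sub>E UNIV. ?h w = H}"
    if H: "H \<in> simple_hypergraphs r n k" for H
  proof (intro equalityI subsetI)
    fix w assume "w \<in> {w \<in> ({..<m} \<times> {..<r}) \<rightarrow>\<^sub>E UNIV. ?h w = H}"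
    then have ext: "w \<in> slots \<rightarrow>\<^sub>E UNIV" and h: "?h w = H" by (auto simp: slots_def)
    have on: "\<And>e. e \<in># H \<Longrightarrow> set_mset e \<subseteq> {1..n}" and lp: "\<And>e v. e \<in># H \<Longrightarrow> count e v < 2"
      and rep: "\<And>e. e \<in># H \<Longrightarrow> count H e = 1" and deg: "\<And>i. i \<in> {1..n} \<Longrightarrow> vertex_degree H i = k i"
      using H by (auto simp: simple_hypergraphs_def hypergraph_on_def simple_hypergraph_def is_loop_def not_le)
    have edge_in: "block_edge r w b \<in># H" if "b < m" for b
      using that h by (auto simp: word_hypergraph_def)
    have "image_mset w (mset_set slots) = degree_mset n k"
    proof (rule multiset_eqI)
      fix i
      have "count (image_mset w (mset_set slots)) i = card {s \<in> slots. w s = i}"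
        using card_arrangements_fibre[of w slots "image_mset w (mset_set slots)" i] ext
        by (simp add: arrangements_def)
      also have "\<dots> = vertex_degree H i"
        by (simp add: vertex_degree_word_hypergraph slots_def flip: h)
      also have "\<dots> = count (degree_mset n k) i"
      proof (cases "i \<in> {1..n}")
        case False
        have "count e i = 0" if "e \<in># H" for e using on[OF that] False by (auto simp: not_in_iff[symmetric])
        then have "vertex_degree H i = 0" by (simp add: vertex_degree_def)
        then show ?thesis using False by (auto simp: count_degree_mset)
      qed (simp add: deg count_degree_mset)
      finally show "count (image_mset w (mset_set slots)) i = count (degree_mset n k) i" .
    qed
    then have "w \<in> words" using ext by (simp add: arrangements_def)
    moreover have "nloops w = 0"
    proof -
      have False if "((b, j), (b, j')) \<in> loops w" for b j j'
      proof -
        have b: "b < m" "j \<in> {..<r}" "j' \<in> {..<r}" "j \<noteq> j'" "w (b, j) = w (b, j')"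
          using that by (auto simp: loops_def slots_def)
        then have "card {j, j'} \<le> card {i \<in> {..<r}. w (b, i) = w (b, j')}"
          by (intro card_mono) auto
        then show False using lp[OF edge_in[OF b(1)], of "w (b, j')"] b(4) by (simp add: count_block_edge)
      qed
      then have "loops w = {}" by (auto simp: loops_def)
      then show ?thesis using card_loops[of w] by simp
    qed
    moreover have "inj_on (block_edge r w) {..<m}"
    proof (rule inj_onI)
      fix b b' assume b: "b \<in> {..<m}" "b' \<in> {..<m}" "block_edge r w b = block_edge r w b'"
      have "card {c \<in> {..<m}. block_edge r w c = block_edge r w b} = 1"
        using rep[OF edge_in[of b]] b(1) by (simp add: h[symmetric] count_word_hypergraph)
      then obtain c where "{c \<in> {..<m}. block_edge r w c = block_edge r w b} = {c}"
        by (auto simp: card_1_singleton_iff)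
      with b show "b = b'" by (metis (mono_tags, lifting) mem_Collect_eq singletonD)
    qed
    ultimately show "w \<in> {w \<in> simple_words. ?h w = H}" using h by (simp add: simple_words_def)
  qed (auto simp: simple_words_def arrangements_def slots_def)
  have fin: "finite simple_words" by (simp add: simple_words_def)
  have "card simple_words = (\<Sum>H\<in>simple_hypergraphs r n k. \<Sum>w\<in>{w \<in> simple_words. ?h w = H}. 1)"
  proof -
    have "?h ` simple_words \<subseteq> simple_hypergraphs r n k" using to_simple by blast
    then show ?thesis
      using sum.group[OF fin finite_simple_hypergraphs[of r n k], of ?h "\<lambda>_. 1::nat"] by simp
  qed
  also have "\<dots> = (\<Sum>H\<in>simple_hypergraphs r n k. fact m * fact r ^ m)"
  proof (rule sum.cong[OF refl])
    fix H assume H: "H \<in> simple_hypergraphs r n k"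
    have "count e v = 1" if "e \<in># H" "v \<in># e" for e v
    proof -
      have "count e v < 2" using H that by (auto simp: simple_hypergraphs_def simple_hypergraph_def is_loop_def not_le)
      moreover have "0 < count e v" using that by simp
      ultimately show ?thesis by linarith
    qed
    moreover have "\<And>e. e \<in># H \<Longrightarrow> size e = r" "\<And>e. e \<in># H \<Longrightarrow> count H e = 1"
      using H by (auto simp: simple_hypergraphs_def simple_hypergraph_def uniform_hypergraph_def)
    ultimately show "(\<Sum>w\<in>{w \<in> simple_words. ?h w = H}. 1) = fact m * fact r ^ m"
      unfolding fibre[OF H] using card_word_hypergraph_fibre[OF size_simple_hypergraph[OF H M r]] by simp
  qed
  finally show ?thesis by simp
qed

text \<open>The proportion of loop-free words and that of simple words among them multiply; in
  logarithms their errors are \<open>E\<close> and \<open>2 * y\<close>, whence 28 = 12 + 16. The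
  assumption \<open>large\<close> serves twice: it yields \<open>10 * r * K \<le> m * r\<close> and
  keeps \<open>y\<close> at most 1/2.\<close>

lemma card_simple_hypergraphs_estimate:
  assumes r: "3 \<le> r" and dvd: "r dvd deg_sum n k" and K: "0 < K" "\<And>i. i \<in> {1..n} \<Longrightarrow> k i \<le> K"
    and large: "16 * r * K ^ 3 \<le> deg_sum n k"
  defines "M \<equiv> deg_sum n k"
  defines "B \<equiv> fact M / (fact (M div r) * fact r ^ (M div r) * (\<Prod>i=1..n. fact (k i))) :: real"
  shows "0 < card (simple_hypergraphs r n k)"
    and "\<bar>ln (card (simple_hypergraphs r n k) / B) + real (r - 1) * real (deg_sum2 n k) / (2 * real M)\<bar>
      \<le> 28 * (real r)\<^sup>2 * (real K ^ 3 / real M)"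
proof -
  define m where "m = M div r"
  have M: "M = m * r" using dvd by (simp add: m_def M_def)
  interpret block_words m r K "degree_mset n k"
    by unfold_locales (use M K in \<open>auto simp: size_degree_mset count_degree_mset M_def\<close>)
  define C where "C = real (card (simple_hypergraphs r n k))"
  define y where "y = 8 * real r * real K ^ 3 / real M"
  define E where "E = 12 * (real r * real K)\<^sup>2 / real M"
  have K3: "K \<le> K ^ 3" "K\<^sup>2 \<le> K ^ 3" using K(1) by (simp_all add: self_le_power power_increasing)
  have "10 * r * K \<le> 16 * r * K ^ 3" using K3(1) by (intro mult_mono) auto
  with large have M10: "10 * r * K \<le> m * r" using M M_def by linarith
  have "0 < 16 * r * K ^ 3" using r K(1) by simp
  then have Mpos: "0 < M" using large unfolding M_def by linarith
  have "real (16 * r * K ^ 3) \<le> real M" using large unfolding M_def by (rule of_nat_mono)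
  then have y: "0 \<le> y" "y \<le> 1 / 2" using Mpos by (simp_all add: y_def field_simps)
  \<comment> \<open>Since \<open>y\<close> is at most 1/2, the factor \<open>1 - y\<close> can be
    replaced by an exponential.\<close>
  have "- y - 2 * y\<^sup>2 \<le> ln (1 - y)" using y by (rule ln_one_minus_pos_lower_bound)
  moreover have "2 * y\<^sup>2 \<le> y" using y mult_right_mono[of y "1/2" y] by (simp add: power2_eq_square)
  ultimately have "exp (- 2 * y) \<le> exp (ln (1 - y))" by simp
  then have exp_y: "exp (- 2 * y) \<le> 1 - y" using y by simp
  have mu: "expected_loops = real (r - 1) * real (deg_sum2 n k) / (2 * real M)"
  proof -
    have "M2 = deg_sum2 n k" unfolding M2_def deg_sum2_def set_degree_mset
      by (rule sum.mono_neutral_cong_left) (auto simp: count_degree_mset)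
    then show ?thesis by (simp add: expected_loops_def M)
  qed
  have P: "real (card simple_words) = C * (fact m * fact r ^ m)"
    using card_simple_hypergraphs[of n k m r K] M K(2) r by (simp add: C_def M_def)
  have W: "real (card words) * (\<Prod>i=1..n. fact (k i)) = fact M"
  proof -
    have "(\<Prod>x\<in>set_mset (degree_mset n k). fact (count (degree_mset n k) x)) = (\<Prod>i=1..n. fact (k i) :: nat)"
      unfolding set_degree_mset by (rule prod.mono_neutral_cong_left) (auto simp: count_degree_mset)
    then have "card words * (\<Prod>i=1..n. fact (k i)) = fact M" using card_words by (simp add: M)
    then have "real (card words * (\<Prod>i=1..n. fact (k i))) = real (fact M)" by simp
    then show ?thesis by (simp only: of_nat_mult of_nat_prod of_nat_fact)
  qed
  have prod_pos: "0 < (\<Prod>i=1..n. fact (k i) :: real)" by (intro prod_pos) auto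
  have W_pos: "0 < real (card words)" using W prod_pos by (metis fact_gt_zero zero_less_mult_pos2)
  have Z1: "loop_poly 1 = real (card words)" by (simp add: loop_poly_def)
  \<comment> \<open>\<open>B\<close> is the number of words divided by the
    \<open>fact m * fact r ^ m\<close> words per hypergraph, so \<open>C / B\<close> is the
    probability that a random word is simple.\<close>
  have ratio: "C / B = real (card simple_words) / real (card words)"
    unfolding B_def P m_def[symmetric] W[symmetric] using W_pos prod_pos by (simp add: field_simps)
  note Z0 = loop_poly_0_bounds[OF K(1) M10] and SW = simple_words_bounds[OF r K(1) M10]
  have "0 < r" using r by simp
  have "real (card words) * exp (- expected_loops - E - 2 * y) = (loop_poly 1 * exp (- expected_loops - E)) * exp (- 2 * y)"
    by (simp add: Z1 exp_add[symmetric] mult.assoc)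
  also have "\<dots> \<le> loop_poly 0 * exp (- 2 * y)"
    using Z0(1)[OF \<open>0 < r\<close>] by (intro mult_right_mono) (simp_all add: E_def M)
  also have "\<dots> \<le> loop_poly 0 * (1 - y)" by (rule mult_left_mono[OF exp_y]) (simp add: loop_poly_nonneg)
  also have "\<dots> \<le> real (card simple_words)" using SW(1) by (simp add: y_def M mult.commute)
  finally have lower: "exp (- expected_loops - E - 2 * y) \<le> C / B"
    using W_pos by (simp add: ratio field_simps)
  have "real (card simple_words) \<le> real (card words) * exp (- expected_loops + E)"
    using SW(2) Z0(2)[OF \<open>0 < r\<close>] by (simp add: Z1 E_def M)
  then have upper: "C / B \<le> exp (- expected_loops + E)"
    using W_pos by (simp add: ratio field_simps)
  \<comment> \<open>The exponential lower bound already shows that a simple hypergraph exists, which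
    makes the logarithm meaningful.\<close>
  have CB: "0 < C / B" using lower exp_gt_zero less_le_trans by blast
  then show "0 < card (simple_hypergraphs r n k)" by (auto simp: C_def intro!: gr0I)
  have "- expected_loops - E - 2 * y \<le> ln (C / B)" using lower CB by (simp add: ln_ge_iff)
  moreover have "ln (C / B) \<le> - expected_loops + E" using upper CB by (metis ln_exp ln_le_cancel_iff exp_gt_zero)
  moreover have "E + 2 * y \<le> 28 * (real r)\<^sup>2 * (real K ^ 3 / real M)"
  proof -
    have "real (K\<^sup>2) \<le> real (K ^ 3)" using K3(2) by (rule of_nat_mono)
    then have "12 * (real r)\<^sup>2 * (real K)\<^sup>2 \<le> 12 * (real r)\<^sup>2 * real K ^ 3"
      by (intro mult_left_mono) simp_all
    moreover have "real r \<le> (real r)\<^sup>2" using r by (simp add: power2_eq_square)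
    then have "16 * real r * real K ^ 3 \<le> 16 * (real r)\<^sup>2 * real K ^ 3"
      by (intro mult_right_mono) simp_all
    ultimately have "12 * (real r * real K)\<^sup>2 + 16 * real r * real K ^ 3 \<le> 28 * (real r)\<^sup>2 * real K ^ 3"
      by (simp add: power_mult_distrib)
    then have "(12 * (real r * real K)\<^sup>2 + 16 * real r * real K ^ 3) / real M \<le> 28 * (real r)\<^sup>2 * real K ^ 3 / real M"
      by (rule divide_right_mono) simp
    then show ?thesis by (simp add: E_def y_def add_divide_distrib)
  qed
  moreover have "0 \<le> y" by fact
  ultimately have "\<bar>ln (C / B) + expected_loops\<bar> \<le> 28 * (real r)\<^sup>2 * (real K ^ 3 / real M)"
    by linarith
  then show "\<bar>ln (card (simple_hypergraphs r n k) / B) + real (r - 1) * real (deg_sum2 n k) / (2 * real M)\<bar>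
      \<le> 28 * (real r)\<^sup>2 * (real K ^ 3 / real M)"
    by (simp only: C_def mu)
qed

theorem theorem1:
  fixes r :: nat and S :: "nat set" and k :: "nat \<Rightarrow> nat \<Rightarrow> nat"
    and M M2 kmax :: "nat \<Rightarrow> nat"
  defines "M \<equiv> \<lambda>n. deg_sum n (k n)"
    and "M2 \<equiv> \<lambda>n. deg_sum2 n (k n)"
    and "kmax \<equiv> \<lambda>n. deg_max n (k n)"
  assumes "r \<ge> 3"
    and "infinite S" and "\<forall>n\<in>S. n \<ge> 1"
    and "\<forall>n\<in>S. r dvd M n"
    and "filterlim M at_top (at_top_along S)"
    and "\<forall>n\<in>S. kmax n \<ge> 2"
    and "(\<lambda>n. real (kmax n) ^ 3) \<in> o[at_top_along S](\<lambda>n. real (M n))"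
  shows "\<exists>\<epsilon> :: nat \<Rightarrow> real.
      \<epsilon> \<in> O[at_top_along S](\<lambda>n. real (kmax n) ^ 3 / real (M n)) \<and>
      (\<forall>\<^sub>F n in at_top_along S.
         real (card (simple_hypergraphs r n (k n))) =
           fact (M n) / (fact (M n div r) * fact r ^ (M n div r) * (\<Prod>i=1..n. fact (k n i)))
           * exp (- (real (r - 1) * real (M2 n)) / (2 * real (M n)) + \<epsilon> n))"
proof -
  define B :: "nat \<Rightarrow> real" where
    "B n = fact (M n) / (fact (M n div r) * fact r ^ (M n div r) * (\<Prod>i=1..n. fact (k n i)))" for n
  define \<mu> where "\<mu> n = real (r - 1) * real (M2 n) / (2 * real (M n))" for n
  \<comment> \<open>This choice makes the formula an identity as soon as the count is positive; only
    the size of \<open>\<epsilon>\<close> remains to be estimated.\<close>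
  define \<epsilon> where "\<epsilon> n = ln (card (simple_hypergraphs r n (k n)) / B n) + \<mu> n" for n
  have "\<forall>\<^sub>F n in at_top_along S. n \<in> S"
    by (simp add: at_top_along_def eventually_inf_principal)
  \<comment> \<open>The constant \<open>1 / (16 * r)\<close> matches the assumption
    \<open>large\<close> of \<open>card_simple_hypergraphs_estimate\<close>.\<close>
  moreover have "\<forall>\<^sub>F n in at_top_along S. norm (real (kmax n) ^ 3) \<le> 1 / (16 * real r) * norm (real (M n))"
    using assms(4,10) by (intro landau_o.smallD) auto
  ultimately have ev: "\<forall>\<^sub>F n in at_top_along S. 0 < card (simple_hypergraphs r n (k n)) \<and>
      \<bar>\<epsilon> n\<bar> \<le> 28 * (real r)\<^sup>2 * (real (kmax n) ^ 3 / real (M n))"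
  proof eventually_elim
    case (elim n)
    have "real (16 * r * kmax n ^ 3) \<le> real (M n)"
      using elim(2) assms(4) by (simp add: field_simps)
    then have large: "16 * r * kmax n ^ 3 \<le> deg_sum n (k n)"
      unfolding M_def of_nat_le_iff .
    have "k n i \<le> kmax n" if "i \<in> {1..n}" for i
      using that by (auto simp: kmax_def deg_max_def)
    moreover have "0 < kmax n" "r dvd deg_sum n (k n)" using assms(7,9) elim(1) by (auto simp: M_def)
    ultimately show ?case
      using card_simple_hypergraphs_estimate[OF assms(4), of n "k n" "kmax n"] large
      by (auto simp: \<epsilon>_def B_def \<mu>_def M_def M2_def)
  qed
  have "\<epsilon> \<in> O[at_top_along S](\<lambda>n. real (kmax n) ^ 3 / real (M n))"
    using ev by (intro bigoI[of _ "28 * (real r)\<^sup>2"]) (auto elim: eventually_mono)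
  moreover have "\<forall>\<^sub>F n in at_top_along S. real (card (simple_hypergraphs r n (k n))) = B n * exp (- \<mu> n + \<epsilon> n)"
    using ev
  proof eventually_elim
    case (elim n)
    have "0 < B n" by (auto simp: B_def intro!: divide_pos_pos mult_pos_pos prod_pos)
    then show ?case using elim by (simp add: \<epsilon>_def exp_ln)
  qed
  ultimately show ?thesis unfolding B_def \<mu>_def minus_divide_left by blast
qed

end
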